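(* Consider the 1+1 Maxwell system $\varepsilon(x)\partial_t\mathcal{E}=i\partial_x\mathcal{H}$, $i\partial_x\mathcal{E}=-\mu\partial_t\mathcal{H}$ with initial data at $x=0$ of the form $$\mathcal{E}(0,t)=\sum_{m=-M}^{M}\alpha_m e^{i(\omega_0+m\omega)t},\qquad \mathcal{H}(0,t)=\sum_{m=-M}^{M}\beta_m e^{i(\omega_0+m\omega)t},$$ with $\alpha_m,\beta_m\in\mathbb{C}$ and constants $\omega_0,\omega$. Then the unique solution, written in the coordinates $\xi,t$, is $$\begin{aligned} \widetilde{\mathcal{E}}(\xi,t)&=\frac{1}{\sqrt{\widetilde c(\xi)\widetilde\varepsilon(\xi)}}\sum_{m=-M}^{M}e^{i(\omega_0+m\omega)t}\Bigl(\tfrac{c_m^+}{2}e^{i(\omega_0+m\omega)\xi}+\tfrac{c_m^-}{2}e^{-i(\omega_0+m\omega)\xi}\\ &\qquad+c_m^+\sum_{n=0}^\infty a_n(\xi)e^{\frac{n\pi i}{2}}j_n\bigl((\omega_0+m\omega)\xi\bigr)+c_m^-\sum_{n=0}^\infty(-1)^na_n(\xi)e^{\frac{n\pi i}{2}}j_n\bigl((\omega_0+m\omega)\xi\bigr)\Bigr),\\ \widetilde{\mathcal{H}}(\xi,t)&=-\frac{i}{\sqrt{\widetilde c(\xi)\mu}}\sum_{m=-M}^{M}e^{i(\omega_0+m\omega)t}\Bigl(\tfrac{c_m^+}{2}e^{i(\omega_0+m\omega)\xi}-\tfrac{c_m^-}{2}e^{-i(\omega_0+m\omega)\xi}\\ &\qquad+c_m^+\sum_{n=0}^\infty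 b_n(\xi)e^{\frac{n\pi i}{2}}j_n\bigl((\omega_0+m\omega)\xi\bigr)-c_m^-\sum_{n=0}^\infty(-1)^nb_n(\xi)e^{\frac{n\pi i}{2}}j_n\bigl((\omega_0+m\omega)\xi\bigr)\Bigr). \end{aligned}$$
   Context: $\varepsilon(x)>0$ is a real-valued function (the permittivity), $\mu>0$ a constant, $c(x)=1/\sqrt{\varepsilon(x)\mu}$; $\mathcal{E}=E_2+iE_3$, $\mathcal{H}=H_2+iH_3$ are complex-valued functions of $(x,t)$. New variable $\xi(x)=\sqrt{\mu}\int_0^x\sqrt{\varepsilon(s)}ds$; a tilde denotes a function of $x$ rewritten as a function of $\xi$ (e.g. $\widetilde c(\xi(x))=c(x)$, $\widetilde{\mathcal{E}}(\xi(x),t)=\mathcal{E}(x,t)$). $f(\xi)=\sqrt{\widetilde c(0)}/\sqrt{\widetilde c(\xi)}$, assumed continuously differentiable. The constants are $c_m^{\pm}=\sqrt{c(0)}\bigl(\sqrt{\varepsilon(0)}\,\alpha_m\pm i\sqrt{\mu}\,\beta_m\bigr)$. $j_n$ is the spherical Bessel function of order $n$. $P_n(x)=\sum_{k=0}^n l_{k,n}x^k$ is the Legendre polynomial of degree $n$. Recursive integrals: $X^{(0)}\equiv1$, $X^{(n)}(\xi)=n\int_0^\xi X^{(n-1)}(s)\,(f^2(s))^{(-1)^n}ds$; $\widetilde X^{(0)}\equiv1$, $\widetilde X^{(n)}(\xi)=n\int_0^\xi\widetilde X^{(n-1)}(s)\,(f^2(s))^{(-1)^{n-1}}ds$. Define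 $\varphi_k=fX^{(k)}$ for $k$ odd, $\varphi_k=f\widetilde X^{(k)}$ for $k$ even; $\psi_k=\widetilde X^{(k)}/f$ for $k$ odd, $\psi_k=X^{(k)}/f$ for $k$ even. Then $a_n(\xi)=\frac{2n+1}{2}\Bigl(\sum_{k=0}^n\frac{l_{k,n}\varphi_k(\xi)}{\xi^k}-1\Bigr)$ and $b_n(\xi)=\frac{2n+1}{2}\Bigl(\sum_{k=0}^n\frac{l_{k,n}\psi_k(\xi)}{\xi^k}-1\Bigr)$. *)

theory Defs
  imports "HOL-Analysis.Analysis"
begin

definition oint :: "real \<Rightarrow> real \<Rightarrow> (real \<Rightarrow> real) \<Rightarrow> real" where
  "oint a b g = (if a \<le> b then integral {a..b} g else - integral {b..a} g)"

definition cc :: "(real \<Rightarrow> real) \<Rightarrow> real \<Rightarrow> real \<Rightarrow> real" where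
  "cc eps mu x = 1 / sqrt (eps x * mu)"

definition xi :: "(real \<Rightarrow> real) \<Rightarrow> real \<Rightarrow> real \<Rightarrow> real" where
  "xi eps mu x = sqrt mu * oint 0 x (\<lambda>s. sqrt (eps s))"

(* f(xi) = sqrt(c~(0)) / sqrt(c~(xi)),  c~(xi(x)) = c(x) *)
definition fT :: "(real \<Rightarrow> real) \<Rightarrow> real \<Rightarrow> real \<Rightarrow> real" where
  "fT eps mu s = sqrt (cc eps mu 0) / sqrt (cc eps mu (inv (xi eps mu) s))"

fun Xr :: "(real \<Rightarrow> real) \<Rightarrow> nat \<Rightarrow> real \<Rightarrow> real" where
  "Xr f 0 = (\<lambda>_. 1)"
| "Xr f (Suc n) = (\<lambda>z. real (Suc n) *
      oint 0 z (\<lambda>s. Xr f n s * (if even (Suc n) then (f s)^2 else 1 / (f s)^2)))"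

fun Xt :: "(real \<Rightarrow> real) \<Rightarrow> nat \<Rightarrow> real \<Rightarrow> real" where
  "Xt f 0 = (\<lambda>_. 1)"
| "Xt f (Suc n) = (\<lambda>z. real (Suc n) *
      oint 0 z (\<lambda>s. Xt f n s * (if even n then (f s)^2 else 1 / (f s)^2)))"

definition phi :: "(real \<Rightarrow> real) \<Rightarrow> nat \<Rightarrow> real \<Rightarrow> real" where
  "phi f k z = (if odd k then f z * Xr f k z else f z * Xt f k z)"

definition psi :: "(real \<Rightarrow> real) \<Rightarrow> nat \<Rightarrow> real \<Rightarrow> real" where
  "psi f k z = (if odd k then Xt f k z / f z else Xr f k z / f z)"

(* coefficients l_{k,n} of the Legendre polynomial
   P_n(x) = 2^-n \<Sum>_{j=0}^{n div 2} (-1)^j C(n,j) C(2n-2j,n) x^(n-2j) *)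
definition legendre_coeff :: "nat \<Rightarrow> nat \<Rightarrow> real" where
  "legendre_coeff k n = (if k \<le> n \<and> even (n - k)
      then (-1) ^ ((n - k) div 2) * real (n choose ((n - k) div 2)) * real ((n + k) choose n) / 2 ^ n
      else 0)"

definition an :: "(real \<Rightarrow> real) \<Rightarrow> nat \<Rightarrow> real \<Rightarrow> real" where
  "an f n z = (2 * real n + 1) / 2 * ((\<Sum>k=0..n. legendre_coeff k n * phi f k z / z ^ k) - 1)"

definition bn :: "(real \<Rightarrow> real) \<Rightarrow> nat \<Rightarrow> real \<Rightarrow> real" where
  "bn f n z = (2 * real n + 1) / 2 * ((\<Sum>k=0..n. legendre_coeff k n * psi f k z / z ^ k) - 1)"

definition sph_bessel :: "nat \<Rightarrow> real \<Rightarrow> real" where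
  "sph_bessel n z = 2 ^ n * z ^ n *
     (\<Sum>k. (-1) ^ k * fact (k + n) * z ^ (2 * k) / (fact k * fact (2 * k + 2 * n + 1)))"

definition maxwell_solution ::
  "(real \<Rightarrow> real) \<Rightarrow> real \<Rightarrow> (real \<Rightarrow> real \<Rightarrow> complex) \<Rightarrow> (real \<Rightarrow> real \<Rightarrow> complex) \<Rightarrow> bool" where
  "maxwell_solution eps mu E H \<longleftrightarrow>
    (\<exists>Ex Et Hx Ht.
       (\<forall>x t. ((\<lambda>y. E y t) has_vector_derivative Ex x t) (at x)
            \<and> ((\<lambda>s. E x s) has_vector_derivative Et x t) (at t)
            \<and> ((\<lambda>y. H y t) has_vector_derivative Hx x t) (at x)
            \<and> ((\<lambda>s. H x s) has_vector_derivative Ht x t) (at t))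
     \<and> continuous_on UNIV (\<lambda>p. Ex (fst p) (snd p))
     \<and> continuous_on UNIV (\<lambda>p. Et (fst p) (snd p))
     \<and> continuous_on UNIV (\<lambda>p. Hx (fst p) (snd p))
     \<and> continuous_on UNIV (\<lambda>p. Ht (fst p) (snd p))
     \<and> (\<forall>x t. complex_of_real (eps x) * Et x t = \<i> * Hx x t
            \<and> \<i> * Ex x t = - complex_of_real mu * Ht x t))"

definition cplus :: "(real \<Rightarrow> real) \<Rightarrow> real \<Rightarrow> complex \<Rightarrow> complex \<Rightarrow> complex" where
  "cplus eps mu a b = complex_of_real (sqrt (cc eps mu 0)) *
      (complex_of_real (sqrt (eps 0)) * a + \<i> * complex_of_real (sqrt mu) * b)"

definition cminus :: "(real \<Rightarrow> real) \<Rightarrow> real \<Rightarrow> complex \<Rightarrow> complex \<Rightarrow> complex" where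
  "cminus eps mu a b = complex_of_real (sqrt (cc eps mu 0)) *
      (complex_of_real (sqrt (eps 0)) * a - \<i> * complex_of_real (sqrt mu) * b)"

end

theory Submission
  imports Defs
begin

text \<open>
  In the variable \<open>\<xi>\<close> a mode with time factor \<open>exp (i \<kappa> t)\<close> turns the Maxwell system into
  \<open>E' = - \<kappa> h / f\<^sup>2\<close>, \<open>h' = \<kappa> f\<^sup>2 E\<close> with \<open>h = c(0) \<mu> H\<close>; Picard iteration solves it by the series
  \<open>\<Sum>\<^sub>n (\<plusminus>i\<kappa>)\<^sup>n \<phi>\<^sub>n / n!\<close> (for \<open>f E\<close>) and \<open>\<Sum>\<^sub>n (\<plusminus>i\<kappa>)\<^sup>n \<psi>\<^sub>n / n!\<close> (for \<open>h / f\<close>).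
  These become Neumann series of spherical Bessel functions by applying the linear map
  \<open>y\<^sup>k \<mapsto> \<phi>\<^sub>k(\<xi>) / \<xi>\<^sup>k\<close> to the plane wave expansion
  \<open>exp (i w y) = \<Sum>\<^sub>n (2n+1) i\<^sup>n j\<^sub>n(w) P\<^sub>n(y)\<close>; that expansion is proved coefficientwise, where it reduces
  to a telescoping sum, and absolute convergence of the triple series justifies the rearrangement.
  Uniqueness follows from the Riemann invariants \<open>f E \<plusminus> i h / f\<close>, which satisfy an integral inequality
  along the characteristics \<open>t \<plusminus> \<xi> = const\<close> that can be iterated to a bound \<open>C (K |x|)\<^sup>n / n!\<close>.
\<close>

section \<open>Neumann series of spherical Bessel functions\<close>

text \<open>The prefactor of \<open>sph_bessel\<close> is moved inside the sum, so that each term is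
  a single monomial in \<open>w\<close>, of degree \<open>n + 2 * p\<close>.\<close>

definition bessel_term :: "nat \<Rightarrow> nat \<Rightarrow> real \<Rightarrow> real" where
  "bessel_term n p w = 2 ^ n * w ^ n *
     ((-1) ^ p * fact (p + n) * w ^ (2 * p) / (fact p * fact (2 * p + 2 * n + 1)))"

text \<open>
  Up to sign and the factor \<open>1 / k!\<close>, this is the coefficient of \<open>w ^ (k + 2 s)\<close> that the summand
  \<open>n = k + 2 q\<close> contributes to \<open>\<Sum>\<^sub>n (2n+1) i\<^sup>n j\<^sub>n(w) l\<^sub>k\<^sub>,\<^sub>n\<close>.
\<close>

definition neumann_coeff :: "nat \<Rightarrow> nat \<Rightarrow> nat \<Rightarrow> real" where
  "neumann_coeff k q s = real (2 * k + 4 * q + 1) * fact (2 * k + 2 * q) * fact (s + k + q) /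
     (fact (s - q) * fact q * fact (k + q) * fact (2 * s + 2 * k + 2 * q + 1))"

section \<open>Coefficient identities behind the plane wave expansion\<close>

text \<open>With \<open>n = k + 2 * q\<close> both binomials become factorials, and the
  \<open>2 ^ n\<close> of the Bessel term cancels the one in the Legendre coefficient. What remains
  depends on \<open>p\<close> only through \<open>p + q\<close>, which prepares the regrouping by
  \<open>s = p + q\<close>.\<close>

lemma legendre_bessel_term_eq:
  "real (2 * (k + 2 * q) + 1) * legendre_coeff k (k + 2 * q) * bessel_term (k + 2 * q) p w =
     (-1) ^ (p + q) * w ^ (k + 2 * (p + q)) * neumann_coeff k q (p + q) / fact k"
proof -
  have b1: "real ((k + 2 * q) choose q) = fact (k + 2 * q) / (fact q * fact (k + q))"
    by (subst binomial_fact) (simp_all add: mult_2)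
  have b2: "real ((k + 2 * q + k) choose (k + 2 * q)) = fact (2 * k + 2 * q) / (fact (k + 2 * q) * fact k)"
    by (subst binomial_fact) (simp_all add: mult_2 ac_simps)
  have l: "legendre_coeff k (k + 2 * q) =
      (-1) ^ q * (fact (2 * k + 2 * q) / (fact q * fact (k + q) * fact k)) / 2 ^ (k + 2 * q)"
    unfolding legendre_coeff_def using b1 b2 by simp
  have i1: "p + (k + 2 * q) = p + q + k + q" by simp
  have i2: "2 * p + 2 * (k + 2 * q) + 1 = 2 * (p + q) + 2 * k + 2 * q + 1" by simp
  have i3: "2 * (k + 2 * q) + 1 = 2 * k + 4 * q + 1" by simp
  show ?thesis
    unfolding l bessel_term_def neumann_coeff_def i1 i2 i3
    by (simp add: power_add power_mult field_simps del: of_nat_Suc fact_Suc)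
qed

text \<open>The alternating sum telescopes: its partial sums have a closed form that can be checked
  by induction on \<open>Q\<close>. The factor \<open>s\<close> on the left avoids a division by
  \<open>s\<close>, and the factor \<open>s - Q\<close> on the right makes the full sum
  vanish.\<close>

lemma alternating_sum_neumann_coeff_partial:
  assumes "Q \<le> s"
  shows "real s * (\<Sum>q\<le>Q. (-1) ^ q * neumann_coeff k q s) =
    (-1) ^ Q * real (s - Q) * real (2 * k + 2 * Q + 1) * fact (2 * k + 2 * Q) * fact (s + k + Q) /
     (fact (k + Q) * fact Q * fact (s - Q) * fact (2 * s + 2 * k + 2 * Q + 1))"
  using assms
proof (induction Q)
  case 0
  then show ?case by (simp add: neumann_coeff_def field_simps)
next
  case (Suc Q)
  \<comment> \<open>Writing \<open>s = Suc Q + r\<close> removes the truncated subtractions; the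
    remaining factorials differ from those of \<open>a\<close>, \<open>b\<close>, \<open>Q\<close>,
    \<open>r\<close> by small shifts only.\<close>
  then obtain r where s: "s = Suc Q + r" using le_Suc_ex by blast
  have IH: "real s * (\<Sum>q\<le>Q. (-1) ^ q * neumann_coeff k q s) =
    (-1) ^ Q * real (s - Q) * real (2 * k + 2 * Q + 1) * fact (2 * k + 2 * Q) * fact (s + k + Q) /
     (fact (k + Q) * fact Q * fact (s - Q) * fact (2 * s + 2 * k + 2 * Q + 1))"
    using Suc by simp
  have d: "s - Q = Suc r" "s - Suc Q = r" using s by auto
  define a where "a = s + k + Q"
  define b where "b = k + Q"
  have e: "s + k + Suc Q = Suc a" "k + Suc Q = Suc b" "2 * k + 2 * Suc Q = Suc (Suc (2*b))"
     "2 * k + 2 * Q = 2 * b" "s + k + Q = a" "k + Q = b"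
     "2 * s + 2 * k + 2 * Q + 1 = Suc (2*a)" "2 * s + 2 * k + 2 * Suc Q + 1 = Suc (Suc (Suc (2*a)))"
     "2 * k + 4 * Suc Q + 1 = 2*b + 2 * Suc Q + 3"
    by (auto simp: a_def b_def)
  have ab: "real a = real b + real Q + 1 + real r" "real s = real Q + 1 + real r"
    by (auto simp: a_def b_def s)
  \<comment> \<open>\<open>C\<close> is chosen so that the closed form at \<open>Q\<close> is
    \<open>C * (2 * b + 1)\<close>; the next summand and the closed form at \<open>Suc Q\<close> are
    multiples of the same quantity.\<close>
  define C :: real where "C = (-1) ^ Q * fact (2 * b) * fact a / (fact b * fact Q * fact r * fact (Suc (2 * a)))"
  have t1: "(-1) ^ Q * real (Suc r) * real (2 * b + 1) * fact (2 * b) * fact a /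
      (fact b * fact Q * fact (Suc r) * fact (Suc (2 * a))) = C * real (2 * b + 1)"
    by (simp add: C_def fact_Suc[of r] mult_ac del: of_nat_Suc fact_Suc)
  have f1: "(fact (Suc (Suc (2 * b))) :: real) / fact (Suc b) = 2 * real (2 * b + 1) * fact (2 * b) / fact b"
  proof -
    have "(fact (Suc (Suc (2 * b))) :: real) = (2 * real (Suc b)) * (real (2 * b + 1) * fact (2 * b))"
      by (simp add: algebra_simps)
    moreover have "(fact (Suc b) :: real) = real (Suc b) * fact b" by simp
    ultimately show ?thesis by (simp only:) (simp del: of_nat_Suc)
  qed
  have f2: "(fact (Suc a) :: real) / fact (Suc (Suc (Suc (2 * a)))) =
      fact a / (2 * real (2 * a + 3) * fact (Suc (2 * a)))"
  proof -
    have "(fact (Suc (Suc (Suc (2 * a)))) :: real) = (2 * real (Suc a)) * (real (2 * a + 3) * fact (Suc (2 * a)))"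
      by (simp only: fact_Suc) (simp add: algebra_simps)
    moreover have "(fact (Suc a) :: real) = real (Suc a) * fact a" by simp
    ultimately show ?thesis by (simp only:) (simp del: of_nat_Suc fact_Suc)
  qed
  have t2: "x * y * fact (Suc (Suc (2 * b))) * fact (Suc a) /
      (fact r * fact (Suc Q) * fact (Suc b) * fact (Suc (Suc (Suc (2 * a))))) =
      x * y * real (2 * b + 1) * fact (2 * b) * fact a /
        (fact b * fact Q * fact r * fact (Suc (2 * a))) / (real (Suc Q) * real (2 * a + 3))"
    for x y :: real
  proof -
    have "x * y * fact (Suc (Suc (2 * b))) * fact (Suc a) /
      (fact r * fact (Suc Q) * fact (Suc b) * fact (Suc (Suc (Suc (2 * a))))) =
      x * y / (fact r * (real (Suc Q) * fact Q)) * (fact (Suc (Suc (2 * b))) / fact (Suc b)) *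
        (fact (Suc a) / fact (Suc (Suc (Suc (2 * a)))))"
      by (simp add: fact_Suc[of Q] del: fact_Suc of_nat_Suc)
    then show ?thesis unfolding f1 f2 by (simp add: mult_ac del: fact_Suc of_nat_Suc of_nat_add of_nat_mult)
  qed
  define D where "D = real (Suc Q) * real (2 * a + 3)"
  have D: "D \<noteq> 0" by (simp add: D_def del: of_nat_Suc)
  have t3: "real s * ((-1) ^ Suc Q * (real (2 * b + 2 * Suc Q + 3) * fact (Suc (Suc (2 * b))) * fact (Suc a) /
      (fact r * fact (Suc Q) * fact (Suc b) * fact (Suc (Suc (Suc (2 * a))))))) =
      - C * real (2 * b + 1) * (real s * real (2 * b + 2 * Suc Q + 3)) / D"
    using t2[of 1 "real (2 * b + 2 * Suc Q + 3)"]
    by (simp add: C_def D_def del: fact_Suc of_nat_Suc)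
  have t4: "(-1) ^ Suc Q * real r * real (2 * b + 3) * fact (Suc (Suc (2 * b))) * fact (Suc a) /
     (fact (Suc b) * fact (Suc Q) * fact r * fact (Suc (Suc (Suc (2 * a))))) =
      - C * real (2 * b + 1) * (real r * real (2 * b + 3)) / D"
    using t2[of "(-1) ^ Suc Q * real r" "real (2 * b + 3)"]
    by (simp add: C_def D_def mult_ac del: fact_Suc of_nat_Suc)
  \<comment> \<open>Without the common factor \<open>x\<close> the induction step reads
    \<open>1 - y / D = - z / D\<close>, that is, \<open>D = y - z\<close>, a polynomial identity in
    \<open>b\<close>, \<open>Q\<close>, \<open>r\<close>.\<close>
  define x y z where "x = C * real (2 * b + 1)" and "y = real s * real (2 * b + 2 * Suc Q + 3)"
    and "z = real r * real (2 * b + 3)"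
  have "D = y - z"
    by (simp add: D_def y_def z_def ab algebra_simps)
  then have "x + - x * y / D = - x * z / D"
    using D by (simp add: divide_simps) (simp add: algebra_simps)
  then have "C * real (2 * b + 1) + - C * real (2 * b + 1) * (real s * real (2 * b + 2 * Suc Q + 3)) / D =
      - C * real (2 * b + 1) * (real r * real (2 * b + 3)) / D"
    unfolding x_def y_def z_def by (simp only: mult_minus_left)
  note key = this
  have e': "Suc (Suc (2 * b)) + 1 = 2 * b + 3" by simp
  show ?case
    unfolding sum.atMost_Suc distrib_left IH neumann_coeff_def[of k "Suc Q" s] d e t1 t3 e' t4 by (rule key)
qed

text \<open>For \<open>s > 0\<close> the closed form at \<open>Q = s\<close> carries the factor
  \<open>s - Q = 0\<close>. This is the plane wave expansion on the level of coefficients: among the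
  powers of \<open>w\<close> that accompany \<open>y ^ k\<close>, all but \<open>w ^ k\<close>
  cancel.\<close>

lemma alternating_sum_neumann_coeff:
  "(\<Sum>q\<le>s. (-1) ^ q * neumann_coeff k q s) = (if s = 0 then 1 else 0)"
proof (cases "s = 0")
  case True
  have "fact (2 * k + 1) = (2 * real k + 1) * fact (2 * k)" by simp
  then show ?thesis using True by (simp add: neumann_coeff_def)
next
  case False
  then show ?thesis using alternating_sum_neumann_coeff_partial[of s s k] by simp
qed

text \<open>Dominates the triple series by a product of exponential series, uniformly in
  \<open>k\<close>. With \<open>m = k + q\<close> and \<open>s = p + q\<close> the coefficient is
  \<open>1 / (fact p * fact q)\<close> times two quotients that are at most 1; induction on
  \<open>s\<close> treats the one made of factorials.\<close>

lemma neumann_coeff_bounds: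
  "0 \<le> neumann_coeff k q (p + q)" "neumann_coeff k q (p + q) \<le> 1 / (fact p * fact q)"
proof -
  have fle: "fact (s + m) * fact (2 * m) \<le> fact m * (fact (2 * s + 2 * m) :: real)" for s m :: nat
  proof (induction s)
    case (Suc s)
    have "fact (Suc s + m) * fact (2 * m) = real (s + m + 1) * (fact (s + m) * fact (2 * m))"
      by (simp add: algebra_simps)
    also have "\<dots> \<le> real (s + m + 1) * (fact m * (fact (2 * s + 2 * m) :: real))"
      by (intro mult_left_mono Suc) simp
    also have "\<dots> \<le> real ((2 * s + 2 * m + 2) * (2 * s + 2 * m + 1)) * (fact m * (fact (2 * s + 2 * m) :: real))"
      by (intro mult_right_mono) (simp_all del: of_nat_mult of_nat_add of_nat_Suc)
    also have "\<dots> = fact m * fact (2 * Suc s + 2 * m)"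
      by (simp add: algebra_simps)
    finally show ?case .
  qed simp
  define s where "s = p + q"
  define m where "m = k + q"
  show "0 \<le> neumann_coeff k q (p + q)" by (simp add: neumann_coeff_def)
  have "neumann_coeff k q (p + q) = (real (2 * k + 4 * q + 1) / real (2 * s + 2 * m + 1)) *
     (fact (s + m) * fact (2 * m) / (fact m * fact (2 * s + 2 * m))) / (fact p * fact q)"
    by (simp add: neumann_coeff_def s_def m_def algebra_simps)
  also have "\<dots> \<le> 1 * 1 / (fact p * fact q)"
    using fle[of s m]
    by (intro divide_right_mono mult_mono) (auto simp: s_def m_def)
  finally show "neumann_coeff k q (p + q) \<le> 1 / (fact p * fact q)" by simp
qed

section \<open>Absolute convergence and rearrangement\<close>

lemma bessel_term_has_sum:
  "((\<lambda>p. bessel_term n p w) has_sum sph_bessel n w) UNIV"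
proof -
  have "summable (\<lambda>p. norm (bessel_term n p w))"
  proof (rule summable_comparison_test)
    show "summable (\<lambda>p. 2 ^ n * \<bar>w\<bar> ^ n * ((w ^ 2) ^ p / fact p))"
      using summable_exp[of "w ^ 2"] by (intro summable_mult) (simp add: field_simps)
    show "\<exists>N. \<forall>p\<ge>N. norm (norm (bessel_term n p w)) \<le> 2 ^ n * \<bar>w\<bar> ^ n * ((w ^ 2) ^ p / fact p)"
    proof (intro exI[of _ 0] allI impI)
      fix p :: nat
      have f: "fact (p + n) \<le> (fact (2 * p + 2 * n + 1) :: real)" by (rule fact_mono) simp
      have "norm (norm (bessel_term n p w)) =
         2 ^ n * \<bar>w\<bar> ^ n * ((w ^ 2) ^ p / fact p * (fact (p + n) / fact (2 * p + 2 * n + 1)))"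
        by (simp add: bessel_term_def abs_mult power_abs power_mult del: fact_Suc)
      also have "\<dots> \<le> 2 ^ n * \<bar>w\<bar> ^ n * ((w ^ 2) ^ p / fact p * 1)"
        using f by (intro mult_left_mono) (simp_all del: fact_Suc)
      finally show "norm (norm (bessel_term n p w)) \<le> 2 ^ n * \<bar>w\<bar> ^ n * ((w ^ 2) ^ p / fact p)" by simp
    qed
  qed
  moreover have "(\<lambda>p. bessel_term n p w) sums sph_bessel n w"
  proof -
    have "summable (\<lambda>p. (-1) ^ p * fact (p + n) * w ^ (2 * p) / (fact p * fact (2 * p + 2 * n + 1)))"
      if "w \<noteq> 0"
    proof -
      have "summable (\<lambda>p. bessel_term n p w / (2 ^ n * w ^ n))"
        by (rule summable_divide) (rule summable_norm_cancel, fact)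
      then show ?thesis using that by (simp add: bessel_term_def del: fact_Suc)
    qed
    \<comment> \<open>At \<open>w = 0\<close> the prefactor \<open>w ^ n\<close> cannot be divided
      out, but then only the term of index 0 can be nonzero.\<close>
    moreover have "summable (\<lambda>p. (-1) ^ p * fact (p + n) * w ^ (2 * p) / (fact p * fact (2 * p + 2 * n + 1)))"
      if "w = 0"
      by (rule summable_finite[of "{0}"]) (use that in auto)
    ultimately show ?thesis
      unfolding bessel_term_def sph_bessel_def by (intro sums_mult summable_sums) blast
  qed
  ultimately show ?thesis by (rule norm_summable_imp_has_sum)
qed

lemma summable_on_times:
  fixes a :: "'a \<Rightarrow> real" and b :: "'b \<Rightarrow> real"
  assumes "a summable_on A" "b summable_on B" "\<And>x. x \<in> A \<Longrightarrow> a x \<ge> 0" "\<And>y. y \<in> B \<Longrightarrow> b y \<ge> 0"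
  shows "(\<lambda>(x, y). a x * b y) summable_on A \<times> B"
  using assms
  by (intro summable_on_SigmaI[where g = "\<lambda>x. a x * infsum b B"])
     (auto intro!: has_sum_cmult_right summable_on_cmult_left)

text \<open>For \<open>d k = y ^ k\<close> this is the expansion of \<open>exp (i w y)\<close>; a
  general \<open>d\<close> makes it applicable to the formal powers. One absolutely summable family
  is summed in two orders: collecting by the degree \<open>n\<close> gives the Bessel series,
  collecting by \<open>k\<close> gives the power series in \<open>w\<close>.\<close>

lemma neumann_series:
  fixes d :: "nat \<Rightarrow> real" and w :: real
  assumes d: "summable (\<lambda>k. \<bar>w\<bar> ^ k * \<bar>d k\<bar> / fact k)"
  shows "(\<lambda>n. \<i> ^ n * complex_of_real ((2 * real n + 1) * sph_bessel n w *
            (\<Sum>k=0..n. legendre_coeff k n * d k)))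
         sums (\<Sum>k. (\<i> * complex_of_real w) ^ k * complex_of_real (d k) / fact k)"
proof -
  \<comment> \<open>\<open>k\<close> is the power of \<open>y\<close>, \<open>n = k + 2 * q\<close>
    runs through the degrees whose Legendre polynomial contains that power, and \<open>p\<close>
    indexes the power series of \<open>j_n\<close>. Three free indices absorb the parity and range
    constraints.\<close>
  define F :: "nat \<times> nat \<times> nat \<Rightarrow> complex" where
    "F = (\<lambda>(k, q, p). \<i> ^ (k + 2 * q) * complex_of_real (real (2 * (k + 2 * q) + 1) *
            legendre_coeff k (k + 2 * q) * bessel_term (k + 2 * q) p w * d k))"
  have F_eq: "F (k, q, p) = (\<i> * complex_of_real w) ^ k * complex_of_real (d k) / fact k *
      complex_of_real ((-1) ^ p * w ^ (2 * (p + q)) * neumann_coeff k q (p + q))" for k q p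
    unfolding F_def prod.case legendre_bessel_term_eq
    by (simp add: power_add power_mult power_mult_distrib flip: power_mult_distrib)
  have norm_F: "norm (F (k, q, p)) \<le>
      \<bar>w\<bar> ^ k * \<bar>d k\<bar> / fact k * ((w\<^sup>2) ^ q / fact q * ((w\<^sup>2) ^ p / fact p))" for k q p
  proof -
    have "norm (F (k, q, p)) = \<bar>w\<bar> ^ k * \<bar>d k\<bar> / fact k * ((w\<^sup>2) ^ (p + q) * neumann_coeff k q (p + q))"
      unfolding F_eq using neumann_coeff_bounds(1)[of k q p]
      by (simp add: norm_mult norm_divide norm_power abs_mult power_even_abs power_abs flip: power_mult)
    also have "\<dots> \<le> \<bar>w\<bar> ^ k * \<bar>d k\<bar> / fact k * ((w\<^sup>2) ^ (p + q) * (1 / (fact p * fact q)))"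
      by (intro mult_left_mono neumann_coeff_bounds(2)) simp_all
    finally show ?thesis by (simp add: power_add mult_ac)
  qed
  have ex: "(\<lambda>q. (w\<^sup>2) ^ q / fact q) summable_on UNIV"
    using summable_exp[of "w ^ 2"] by (intro summable_nonneg_imp_summable_on) (simp_all add: field_simps)
  have dd: "(\<lambda>k. \<bar>w\<bar> ^ k * \<bar>d k\<bar> / fact k) summable_on UNIV"
    using d by (intro summable_nonneg_imp_summable_on) simp_all
  have "(\<lambda>(k, q, p). \<bar>w\<bar> ^ k * \<bar>d k\<bar> / fact k * ((w\<^sup>2) ^ q / fact q * ((w\<^sup>2) ^ p / fact p)))
      summable_on UNIV \<times> (UNIV \<times> UNIV)"
    using summable_on_times[OF dd summable_on_times[OF ex ex]] by (simp add: case_prod_unfold)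
  then have "(\<lambda>x. norm (F x)) summable_on UNIV"
    unfolding UNIV_Times_UNIV
    by (rule Infinite_Sum.abs_summable_on_comparison_test') (use norm_F in auto)
  then have "F summable_on UNIV" by (rule abs_summable_summable)
  then obtain S where S: "(F has_sum S) UNIV" by (auto simp: summable_on_def)

  \<comment> \<open>First order of summation: \<open>p\<close> innermost restores
    \<open>sph_bessel n w\<close>, after which the sum over \<open>k\<close> is finite for each
    \<open>n\<close>.\<close>
  have "((\<lambda>((n, k), p). F (k, (n - k) div 2, p)) has_sum S)
      ((SIGMA n:UNIV. {k. k \<le> n \<and> even (n - k)}) \<times> UNIV)"
    by (rule has_sum_reindex_bij_witness[where j = "\<lambda>(k, q, p). ((k + 2 * q, k), p)"
          and i = "\<lambda>((n, k), p). (k, (n - k) div 2, p)", THEN iffD1, OF _ _ _ _ _ _ S])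
       auto
  then have "((\<lambda>(n, k). \<i> ^ n * complex_of_real (real (2 * n + 1) * legendre_coeff k n * sph_bessel n w * d k))
      has_sum S) (SIGMA n:UNIV. {k. k \<le> n \<and> even (n - k)})"
  proof (rule has_sum_SigmaD)
    fix x :: "nat \<times> nat" assume x: "x \<in> (SIGMA n:UNIV. {k. k \<le> n \<and> even (n - k)})"
    obtain n k where nk: "x = (n, k)" by (cases x)
    with x have "k \<le> n" "even (n - k)" by (simp_all only: mem_Sigma_iff mem_Collect_eq)
    then obtain q where "k \<le> n" "n - k = 2 * q" by (metis evenE)
    then have q: "n = k + 2 * q" by simp
    have "((\<lambda>p. of_real (bessel_term n p w)) has_sum complex_of_real (sph_bessel n w)) UNIV"
      by (intro has_sum_of_real bessel_term_has_sum)
    from has_sum_cmult_right[OF this, of "\<i> ^ n * complex_of_real (real (2 * n + 1) * legendre_coeff k n * d k)"]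
    show "((\<lambda>p. case (x, p) of (x, xa) \<Rightarrow> (case x of (n, k) \<Rightarrow> \<lambda>p. F (k, (n - k) div 2, p)) xa) has_sum
          (case x of (n, k) \<Rightarrow> \<i> ^ n * complex_of_real (real (2 * n + 1) * legendre_coeff k n * sph_bessel n w * d k))) UNIV"
      unfolding nk q by (simp add: F_def mult_ac)
  qed
  then have "((\<lambda>n. \<i> ^ n * complex_of_real ((2 * real n + 1) * sph_bessel n w *
            (\<Sum>k=0..n. legendre_coeff k n * d k))) has_sum S) UNIV"
  proof (rule has_sum_SigmaD)
    fix n :: nat
    have "(\<Sum>k=0..n. legendre_coeff k n * d k) = (\<Sum>k | k \<le> n \<and> even (n - k). legendre_coeff k n * d k)"
      by (rule sum.mono_neutral_right) (auto simp: legendre_coeff_def)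
    then show "((\<lambda>k. case (n, k) of (n, k) \<Rightarrow> \<i> ^ n * complex_of_real (real (2 * n + 1) * legendre_coeff k n * sph_bessel n w * d k))
        has_sum \<i> ^ n * complex_of_real ((2 * real n + 1) * sph_bessel n w *
            (\<Sum>k=0..n. legendre_coeff k n * d k))) {k. k \<le> n \<and> even (n - k)}"
      by (intro has_sum_finiteI) (auto simp: sum_distrib_left mult_ac add.commute)
  qed
  then have sums1: "(\<lambda>n. \<i> ^ n * complex_of_real ((2 * real n + 1) * sph_bessel n w *
            (\<Sum>k=0..n. legendre_coeff k n * d k))) sums S"
    by (rule has_sum_imp_sums)

  \<comment> \<open>Second order: for fixed \<open>k\<close> and \<open>s = p + q\<close> the finite
    sum over \<open>q\<close> is the alternating sum above, so only \<open>s = 0\<close>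
    survives.\<close>
  have "((\<lambda>((k, s), q). F (k, q, s - q)) has_sum S) (SIGMA (k, s):UNIV \<times> UNIV. {..s})"
    by (rule has_sum_reindex_bij_witness[where j = "\<lambda>(k, q, p). ((k, p + q), q)"
          and i = "\<lambda>((k, s), q). (k, q, s - q)", THEN iffD1, OF _ _ _ _ _ _ S])
       auto
  then have "((\<lambda>(k, s::nat). if s = 0 then (\<i> * complex_of_real w) ^ k * complex_of_real (d k) / fact k else 0)
      has_sum S) (UNIV \<times> UNIV)"
  proof (rule has_sum_SigmaD)
    fix x :: "nat \<times> nat"
    obtain k s where ks: "x = (k, s)" by (cases x)
    have "(\<Sum>q\<le>s. F (k, q, s - q)) = (\<Sum>q\<le>s. (\<i> * complex_of_real w) ^ k * complex_of_real (d k) / fact k *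
        complex_of_real ((-1) ^ s * w ^ (2 * s)) * complex_of_real ((-1) ^ q * neumann_coeff k q s))"
    proof (rule sum.cong)
      fix q assume q: "q \<in> {..s}"
      then have "(-1 :: real) ^ (s - q) = (-1) ^ s * (-1) ^ q"
        by (auto simp: power_add le_iff_add simp flip: power_mult_distrib)
      then show "F (k, q, s - q) = (\<i> * complex_of_real w) ^ k * complex_of_real (d k) / fact k *
        complex_of_real ((-1) ^ s * w ^ (2 * s)) * complex_of_real ((-1) ^ q * neumann_coeff k q s)"
        using q by (simp add: F_eq mult_ac)
    qed simp
    also have "\<dots> = (\<i> * complex_of_real w) ^ k * complex_of_real (d k) / fact k *
        complex_of_real ((-1) ^ s * w ^ (2 * s)) * complex_of_real (if s = 0 then 1 else 0)"
      unfolding alternating_sum_neumann_coeff[of k s, symmetric] of_real_sum by (simp only: sum_distrib_left)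
    finally show "((\<lambda>q. case (x, q) of (x, xa) \<Rightarrow> (case x of (k, s) \<Rightarrow> \<lambda>q. F (k, q, s - q)) xa) has_sum
          (case x of (k, s) \<Rightarrow> if s = 0 then (\<i> * complex_of_real w) ^ k * complex_of_real (d k) / fact k else 0))
          (case x of (k, s) \<Rightarrow> {..s})"
      unfolding ks by (intro has_sum_finiteI) auto
  qed
  then have "((\<lambda>k. (\<i> * complex_of_real w) ^ k * complex_of_real (d k) / fact k) has_sum S) UNIV"
  proof (rule has_sum_SigmaD)
    fix k :: nat
    show "((\<lambda>s. case (k, s) of (k, s) \<Rightarrow> if s = 0 then (\<i> * complex_of_real w) ^ k * complex_of_real (d k) / fact k else 0)
        has_sum (\<i> * complex_of_real w) ^ k * complex_of_real (d k) / fact k) UNIV"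
      by (rule has_sum_finite_neutralI[of "{0}"]) auto
  qed
  then have "(\<lambda>k. (\<i> * complex_of_real w) ^ k * complex_of_real (d k) / fact k) sums S"
    by (rule has_sum_imp_sums)
  with sums1 show ?thesis by (simp add: sums_iff)
qed

section \<open>Formal powers\<close>

text \<open>Provides a compact interval for uniform bounds that has both 0 and \<open>z\<close> in
  its interior, so that derivatives within it are two-sided at \<open>z\<close>.\<close>

lemma open_convex_interval:
  fixes S :: "real set"
  assumes "open S" "convex S" "0 \<in> S" "z \<in> S"
  obtains a b where "{a..b} \<subseteq> S" "a < 0" "0 < b" "a < z" "z < b"
proof -
  obtain e where e: "e > 0" "ball 0 e \<subseteq> S" using assms openE by blast
  obtain d where d: "d > 0" "ball z d \<subseteq> S" using assms openE by blast
  define a where "a = min (- e / 2) (z - d / 2)"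
  define b where "b = max (e / 2) (z + d / 2)"
  have "- e / 2 \<in> S" "e / 2 \<in> S" using e by (auto intro!: subsetD[OF e(2)] simp: dist_norm)
  moreover have "z - d / 2 \<in> S" "z + d / 2 \<in> S" using d by (auto intro!: subsetD[OF d(2)] simp: dist_norm)
  ultimately have ab: "a \<in> S" "b \<in> S" unfolding a_def b_def min_def max_def by auto
  have lt: "a < 0" "a < z" "0 < b" "z < b" using e d by (auto simp: a_def b_def)
  have sub: "{a..b} \<subseteq> S"
    using assms(2) ab by (metis closed_segment_eq_real_ivl closed_segment_subset lt(1,3) less_trans less_imp_le)
  then show ?thesis using lt that by blast
qed

lemma oint_0_has_real_derivative:
  assumes "open S" "convex S" "0 \<in> S" "z \<in> S" and g: "continuous_on S g"
  shows "((\<lambda>y. oint 0 y g) has_real_derivative g z) (at z)"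
proof -
  obtain a b where sub: "{a..b} \<subseteq> S" and lt: "a < 0" "0 < b" "a < z" "z < b"
    using open_convex_interval[OF assms(1-4)] by blast
  have cont: "continuous_on {a..b} g" using g sub continuous_on_subset by blast
  \<comment> \<open>Moving the base point from 0 to \<open>a\<close> gives one formula on both sides
    of 0, to which the fundamental theorem of calculus applies directly.\<close>
  have eq: "oint 0 y g = integral {a..y} g - integral {a..0} g" if "y \<in> {a<..<b}" for y
  proof (cases "0 \<le> y")
    case True
    have "integral {a..0} g + integral {0..y} g = integral {a..y} g"
      using that True lt cont
      by (intro Henstock_Kurzweil_Integration.integral_combine integrable_continuous_real)
         (auto intro: continuous_on_subset)
    then show ?thesis using True by (simp add: oint_def)
  next
    case False
    have "integral {a..y} g + integral {y..0} g = integral {a..0} g"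
      using that False lt cont
      by (intro Henstock_Kurzweil_Integration.integral_combine integrable_continuous_real)
         (auto intro: continuous_on_subset)
    then show ?thesis using False by (simp add: oint_def)
  qed
  have "((\<lambda>y. integral {a..y} g) has_real_derivative g z) (at z within {a..b})"
    by (rule integral_has_real_derivative[OF cont]) (use lt in auto)
  then have "((\<lambda>y. integral {a..y} g) has_real_derivative g z) (at z)"
    using lt by (simp add: at_within_Icc_at)
  then have "((\<lambda>y. integral {a..y} g - integral {a..0} g) has_real_derivative g z) (at z)"
    using DERIV_diff[OF _ DERIV_const] by fastforce
  then show ?thesis
    by (rule has_field_derivative_transform_within_open[of _ _ _ "{a<..<b}"]) (use lt eq in auto)
qed

text \<open>Mean value inequality with the majorant \<open>C * s ^ Suc n / Suc n\<close>. It is the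
  single integration step that is iterated both for the formal powers and for uniqueness.\<close>

lemma norm_diff_zero_le_power:
  fixes F :: "real \<Rightarrow> 'a::real_normed_vector"
  assumes F: "\<And>s. s \<in> closed_segment 0 y \<Longrightarrow> (F has_vector_derivative F' s) (at s)"
    and bound: "\<And>s. s \<in> closed_segment 0 y \<Longrightarrow> norm (F' s) \<le> C * \<bar>s\<bar> ^ n"
  shows "norm (F y - F 0) \<le> C * \<bar>y\<bar> ^ Suc n / real (Suc n)"
proof -
  have pos: "norm (G u - G 0) \<le> C * u ^ Suc n / real (Suc n)"
    if u: "u > 0" and G: "\<And>s. s \<in> {0..u} \<Longrightarrow> (G has_vector_derivative G' s) (at s)"
      and b: "\<And>s. s \<in> {0..u} \<Longrightarrow> norm (G' s) \<le> C * s ^ n" for G :: "real \<Rightarrow> 'a" and G' u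
  proof -
    have "norm (G u - G 0) \<le> C * u ^ Suc n / real (Suc n) - C * 0 ^ Suc n / real (Suc n)"
    proof (rule differentiable_bound_general[where \<phi> = "\<lambda>s. C * s ^ Suc n / real (Suc n)" and \<phi>' = "\<lambda>s. C * s ^ n" and f' = G'])
      show "continuous_on {0..u} G"
        using G by (meson continuous_at_imp_continuous_on has_vector_derivative_continuous)
      show "((\<lambda>s. C * s ^ Suc n / real (Suc n)) has_vector_derivative C * x ^ n) (at x)" for x
        unfolding has_real_derivative_iff_has_vector_derivative[symmetric]
        by (auto intro!: derivative_eq_intros simp del: power_Suc of_nat_Suc)
    qed (use u G b in \<open>auto intro!: continuous_intros simp del: of_nat_Suc\<close>)
    then show ?thesis by simp
  qed
  consider "y = 0" | "y > 0" | "y < 0" by linarith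
  then show ?thesis
  proof cases
    case 2
    then show ?thesis using pos[of y F F'] F bound by (auto simp: closed_segment_eq_real_ivl)
  next
    case 3
    \<comment> \<open>The case \<open>y < 0\<close> is the positive case for the reflected function
      \<open>s \<mapsto> F (- s)\<close>.\<close>
    have "norm (F (- (- y)) - F (- 0)) \<le> C * (- y) ^ Suc n / real (Suc n)"
    proof (rule pos[where G' = "\<lambda>s. - F' (- s)"])
      show "- y > 0" using 3 by simp
      fix s assume s: "s \<in> {0..- y}"
      then have m: "- s \<in> closed_segment 0 y" using 3 by (auto simp: closed_segment_eq_real_ivl)
      show "((\<lambda>s. F (- s)) has_vector_derivative - F' (- s)) (at s)"
        using vector_diff_chain_at[OF has_vector_derivative_minus[OF has_vector_derivative_id] F[OF m]]
        by (simp add: o_def)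
      show "norm (- F' (- s)) \<le> C * s ^ n" using bound[OF m] s by auto
    qed
    then show ?thesis using 3 by simp
  qed simp
qed

text \<open>
  The functions \<open>\<phi>\<^sub>n / f\<close>. Replacing \<open>f\<close> by \<open>1 / f\<close> exchanges \<open>X\<close> with \<open>X~\<close>, hence \<open>\<phi>\<close> with \<open>\<psi>\<close> and
  \<open>a\<^sub>n\<close> with \<open>b\<^sub>n\<close>, so that only one family has to be studied.
\<close>

definition chi :: "(real \<Rightarrow> real) \<Rightarrow> nat \<Rightarrow> real \<Rightarrow> real" where
  "chi f n z = (if odd n then Xr f n z else Xt f n z)"

section \<open>Formal powers under inversion of the weight\<close>

lemma Xr_inverse: "Xr (\<lambda>s. 1 / f s) n = Xt f n"
proof (induction n)
  case (Suc n)
  then show ?case by (cases "even n") (simp_all add: power_divide)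
qed simp

lemma Xt_inverse: "Xt (\<lambda>s. 1 / f s) n = Xr f n"
  using Xr_inverse[of "\<lambda>s. 1 / f s"] by simp

lemma phi_eq_chi: "phi f k z = f z * chi f k z"
  by (simp add: phi_def chi_def)

lemma psi_eq_phi_inverse: "psi f k z = phi (\<lambda>s. 1 / f s) k z"
  by (simp add: phi_def psi_def Xr_inverse Xt_inverse)

lemma bn_eq_an_inverse: "bn f n z = an (\<lambda>s. 1 / f s) n z"
  by (simp add: an_def bn_def psi_eq_phi_inverse)

lemma chi_0 [simp]: "chi f 0 z = 1"
  by (simp add: chi_def)

text \<open>One recursion serves both parities because the weight is inverted at each step.
  Inductions on \<open>n\<close> therefore have to generalise over \<open>f\<close>.\<close>

lemma chi_Suc: "chi f (Suc n) z = real (Suc n) * oint 0 z (\<lambda>s. chi (\<lambda>s. 1 / f s) n s / (f s)\<^sup>2)"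
  by (simp add: chi_def Xr_inverse Xt_inverse)

lemma chi_Suc_at_0 [simp]: "chi f (Suc n) 0 = 0"
  unfolding chi_Suc by (simp add: oint_def)

text \<open>\<open>S\<close> stands for the range of \<open>xi\<close>, an open interval around 0
  that may be bounded, since the integral of \<open>sqrt (eps s)\<close> may converge at
  infinity.\<close>

locale weight =
  fixes S :: "real set" and f :: "real \<Rightarrow> real"
  assumes open_S: "open S" and convex_S: "convex S" and zero_in_S: "0 \<in> S"
    and continuous_f: "continuous_on S f" and f_pos: "s \<in> S \<Longrightarrow> f s > 0"

lemma weight_inverse: "weight S f \<Longrightarrow> weight S (\<lambda>s. 1 / f s)"
  unfolding weight_def by (auto intro!: continuous_intros simp: less_imp_neq[symmetric])

text \<open>Stated outside the locale since the induction hypothesis is applied to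
  \<open>1 / f\<close>.\<close>

lemma chi_continuous_on: "weight S f \<Longrightarrow> continuous_on S (chi f n)"
proof (induction n arbitrary: f)
  case (Suc n)
  interpret weight S f by fact
  have "continuous_on S (\<lambda>s. chi (\<lambda>s. 1 / f s) n s / (f s)\<^sup>2)"
    using Suc.IH[OF weight_inverse[OF Suc.prems]] f_pos
    by (auto intro!: continuous_intros continuous_f simp: less_imp_neq[symmetric])
  then have "((\<lambda>y. oint 0 y (\<lambda>s. chi (\<lambda>s. 1 / f s) n s / (f s)\<^sup>2)) has_real_derivative
      chi (\<lambda>s. 1 / f s) n z / (f z)\<^sup>2) (at z)" if "z \<in> S" for z
    using that by (rule oint_0_has_real_derivative[OF open_S convex_S zero_in_S, rotated])
  then show ?case
    unfolding chi_Suc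
    by (intro continuous_intros continuous_at_imp_continuous_on) (blast intro: DERIV_isCont)
qed (simp add: chi_def)

context weight
begin

lemma chi_Suc_has_real_derivative:
  assumes "z \<in> S"
  shows "(chi f (Suc n) has_real_derivative real (Suc n) * (chi (\<lambda>s. 1 / f s) n z / (f z)\<^sup>2)) (at z)"
proof -
  have "continuous_on S (\<lambda>s. chi (\<lambda>s. 1 / f s) n s / (f s)\<^sup>2)"
    using chi_continuous_on[OF weight_inverse[OF weight_axioms]] f_pos
    by (auto intro!: continuous_intros continuous_f simp: less_imp_neq[symmetric])
  then show ?thesis
    unfolding chi_Suc
    by (intro DERIV_cmult oint_0_has_real_derivative[OF open_S convex_S zero_in_S assms])
qed

text \<open>A common bound for both weights survives the exchange of \<open>f\<close> and
  \<open>1 / f\<close>.\<close>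

lemma weight_bound:
  assumes "{a..b} \<subseteq> S" "a \<le> b"
  obtains K where "K \<ge> 0" "\<And>s. s \<in> {a..b} \<Longrightarrow> (f s)\<^sup>2 \<le> K" "\<And>s. s \<in> {a..b} \<Longrightarrow> 1 / (f s)\<^sup>2 \<le> K"
proof -
  have ab: "compact {a..b}" by simp
  have "continuous_on {a..b} (\<lambda>s. (f s)\<^sup>2)" "continuous_on {a..b} (\<lambda>s. 1 / (f s)\<^sup>2)"
    using assms f_pos by (auto intro!: continuous_intros continuous_on_subset[OF continuous_f] simp: subset_iff less_imp_neq[symmetric])
  then have "bounded ((\<lambda>s. (f s)\<^sup>2) ` {a..b})" "bounded ((\<lambda>s. 1 / (f s)\<^sup>2) ` {a..b})"
    using ab compact_continuous_image compact_imp_bounded by blast+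
  then obtain K1 K2 where "\<forall>s\<in>{a..b}. \<bar>(f s)\<^sup>2\<bar> \<le> K1" "\<forall>s\<in>{a..b}. \<bar>1 / (f s)\<^sup>2\<bar> \<le> K2"
    unfolding bounded_iff by (metis imageI real_norm_def)
  then show ?thesis by (intro that[of "max 0 (max K1 K2)"]) (force simp: le_max_iff_disj)+
qed

end

text \<open>The factor \<open>Suc n\<close> of the recursion cancels the \<open>1 / Suc n\<close>
  gained by integrating \<open>\<bar>s\<bar> ^ n\<close>, so the growth is geometric and each step
  contributes one factor \<open>K\<close>.\<close>

lemma chi_bound:
  assumes "weight S f" "{a..b} \<subseteq> S" "a \<le> 0" "0 \<le> b"
    and "\<And>s. s \<in> {a..b} \<Longrightarrow> (f s)\<^sup>2 \<le> K" "\<And>s. s \<in> {a..b} \<Longrightarrow> 1 / (f s)\<^sup>2 \<le> K"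
    and "y \<in> {a..b}"
  shows "\<bar>chi f n y\<bar> \<le> (K * \<bar>y\<bar>) ^ n"
  using assms
proof (induction n arbitrary: f y)
  case (Suc n)
  interpret weight S f by fact
  have K: "K \<ge> 0" using Suc.prems(5)[of 0] Suc.prems(3,4) by (smt (verit) atLeastAtMost_iff zero_le_power2)
  have "norm (chi f (Suc n) y - chi f (Suc n) 0) \<le> (real (Suc n) * K ^ Suc n) * \<bar>y\<bar> ^ Suc n / real (Suc n)"
  proof (rule norm_diff_zero_le_power)
    fix s assume "s \<in> closed_segment 0 y"
    then have s: "s \<in> {a..b}" using Suc.prems(3,4,7) by (auto simp: closed_segment_eq_real_ivl split: if_splits)
    then have sS: "s \<in> S" using Suc.prems(2) by blast
    show "(chi f (Suc n) has_vector_derivative real (Suc n) * (chi (\<lambda>s. 1 / f s) n s / (f s)\<^sup>2)) (at s)"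
      using chi_Suc_has_real_derivative[OF sS] by (simp add: has_real_derivative_iff_has_vector_derivative)
    have "\<bar>chi (\<lambda>s. 1 / f s) n s\<bar> \<le> (K * \<bar>s\<bar>) ^ n"
      by (rule Suc.IH) (use Suc.prems s weight_inverse in \<open>auto simp: power_divide\<close>)
    moreover have "1 / (f s)\<^sup>2 \<le> K" "1 / (f s)\<^sup>2 \<ge> 0" using s Suc.prems(6) by auto
    ultimately have "\<bar>chi (\<lambda>s. 1 / f s) n s\<bar> * (1 / (f s)\<^sup>2) \<le> (K * \<bar>s\<bar>) ^ n * K"
      using K by (intro mult_mono) auto
    then show "norm (real (Suc n) * (chi (\<lambda>s. 1 / f s) n s / (f s)\<^sup>2)) \<le> real (Suc n) * K ^ Suc n * \<bar>s\<bar> ^ n"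
      using mult_left_mono[of "\<bar>chi (\<lambda>s. 1 / f s) n s\<bar> * (1 / (f s)\<^sup>2)" "(K * \<bar>s\<bar>) ^ n * K" "real (Suc n)"]
      by (simp add: abs_mult power_mult_distrib mult_ac del: of_nat_Suc)
  qed
  then show ?case by (simp add: power_mult_distrib mult_ac del: of_nat_Suc)
qed simp

section \<open>Power series in the spectral parameter\<close>

text \<open>Spectral parameter power series: \<open>u = spps f l\<close> and
  \<open>v = spps (1 / f) l\<close> solve \<open>u' = l v / f^2\<close>, \<open>v' = l f^2 u\<close>
  with \<open>u = v = 1\<close> at 0.\<close>

definition spps :: "(real \<Rightarrow> real) \<Rightarrow> complex \<Rightarrow> real \<Rightarrow> complex" where
  "spps f l z = (\<Sum>n. l ^ n / fact n * complex_of_real (chi f n z))"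

lemma chi_geometric_bound:
  assumes "weight S f" "z \<in> S"
  obtains K where "K \<ge> 0" "\<And>n. \<bar>chi f n z\<bar> \<le> (K * \<bar>z\<bar>) ^ n"
proof -
  interpret weight S f by fact
  obtain a b where ab: "{a..b} \<subseteq> S" "a < 0" "0 < b" "a < z" "z < b"
    using open_convex_interval[OF open_S convex_S zero_in_S assms(2)] by blast
  obtain K where K: "K \<ge> 0" "\<And>s. s \<in> {a..b} \<Longrightarrow> (f s)\<^sup>2 \<le> K" "\<And>s. s \<in> {a..b} \<Longrightarrow> 1 / (f s)\<^sup>2 \<le> K"
    using weight_bound[OF ab(1)] ab by auto
  show ?thesis by (rule that[OF K(1)]) (rule chi_bound[OF assms(1) ab(1)], use ab K in auto)
qed

lemma spps_summable:
  assumes "weight S f" "z \<in> S"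
  shows "summable (\<lambda>n. norm (l ^ n / fact n * complex_of_real (chi f n z)))"
proof -
  obtain K where K: "K \<ge> 0" "\<And>n. \<bar>chi f n z\<bar> \<le> (K * \<bar>z\<bar>) ^ n"
    using chi_geometric_bound[OF assms] by blast
  show ?thesis
  proof (rule summable_comparison_test)
    show "summable (\<lambda>n. (norm l * (K * \<bar>z\<bar>)) ^ n / fact n)"
      using summable_exp[of "norm l * (K * \<bar>z\<bar>)"] by (simp add: field_simps)
    show "\<exists>N. \<forall>n\<ge>N. norm (norm (l ^ n / fact n * complex_of_real (chi f n z))) \<le> (norm l * (K * \<bar>z\<bar>)) ^ n / fact n"
      using mult_left_mono[OF K(2), of "norm l ^ _ / fact _"]
      by (auto simp: norm_mult norm_divide norm_power power_mult_distrib)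
  qed
qed

lemma spps_at_0: "spps f l 0 = 1"
proof -
  have "(\<lambda>n. l ^ n / fact n * complex_of_real (chi f n 0)) sums (\<Sum>n\<in>{0}. l ^ n / fact n * complex_of_real (chi f n 0))"
  proof (rule sums_finite)
    fix n :: nat assume "n \<notin> {0}"
    then show "l ^ n / fact n * complex_of_real (chi f n 0) = 0" by (cases n) auto
  qed simp
  then show ?thesis by (simp add: spps_def sums_iff)
qed

text \<open>Termwise differentiation: the derivative of term \<open>n + 1\<close> is
  \<open>l / f^2\<close> times term \<open>n\<close> of the series for \<open>1 / f\<close>. The
  Weierstrass test on \<open>{a..b}\<close> supplies the uniform convergence.\<close>

lemma spps_has_vector_derivative:
  assumes "weight S f" "z \<in> S"
  shows "(spps f l has_vector_derivative l * spps (\<lambda>s. 1 / f s) l z / complex_of_real ((f z)\<^sup>2)) (at z)"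
proof -
  interpret weight S f by fact
  note winv = weight_inverse[OF assms(1)]
  obtain a b where ab: "{a..b} \<subseteq> S" "a < 0" "0 < b" "a < z" "z < b"
    using open_convex_interval[OF open_S convex_S zero_in_S assms(2)] by blast
  obtain K where K: "K \<ge> 0" "\<And>s. s \<in> {a..b} \<Longrightarrow> (f s)\<^sup>2 \<le> K" "\<And>s. s \<in> {a..b} \<Longrightarrow> 1 / (f s)\<^sup>2 \<le> K"
    using weight_bound[OF ab(1)] ab by auto
  define R where "R = max (- a) b"
  \<comment> \<open>At \<open>n = 0\<close> the truncated \<open>n - 1\<close> is harmless, because
    the factor \<open>real n\<close> makes \<open>D 0\<close> vanish.\<close>
  define D :: "nat \<Rightarrow> real \<Rightarrow> complex" where
    "D n s = l ^ n / fact n * complex_of_real (real n * (chi (\<lambda>s. 1 / f s) (n - 1) s / (f s)\<^sup>2))" for n s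
  define g where "g s = l * spps (\<lambda>s. 1 / f s) l s / complex_of_real ((f s)\<^sup>2)" for s
  have D_Suc: "D (Suc n) s = l * (l ^ n / fact n * complex_of_real (chi (\<lambda>s. 1 / f s) n s)) / complex_of_real ((f s)\<^sup>2)" for n s
    unfolding D_def by (simp add: field_simps del: of_nat_Suc)
  have suminf_D: "(\<Sum>n. D n s) = g s" if s: "s \<in> {a..b}" for s
  proof -
    have "(\<lambda>n. l ^ n / fact n * complex_of_real (chi (\<lambda>s. 1 / f s) n s)) sums spps (\<lambda>s. 1 / f s) l s"
      unfolding spps_def
      by (intro summable_sums summable_norm_cancel[OF spps_summable[OF winv]]) (use s ab in auto)
    then have "(\<lambda>n. D (Suc n) s) sums g s"
      unfolding D_Suc g_def by (intro sums_divide sums_mult)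
    then have "(\<lambda>n. D n s) sums (g s + D 0 s)" by (rule sums_Suc)
    then show ?thesis by (simp add: D_def sums_iff)
  qed
  \<comment> \<open>An exponential series shifted by one index, obtained from the geometric bound
    and \<open>\<bar>s\<bar> \<le> R\<close> on \<open>{a..b}\<close>.\<close>
  define M where "M n = (if n = 0 then 0 else norm l * K * ((norm l * (K * R)) ^ (n - 1) / fact (n - 1)))" for n
  have D_le: "norm (D n s) \<le> M n" if s: "s \<in> {a..b}" for n s
  proof (cases n)
    case (Suc m)
    have "\<bar>chi (\<lambda>s. 1 / f s) m s\<bar> \<le> (K * \<bar>s\<bar>) ^ m"
      by (rule chi_bound[OF winv ab(1)]) (use ab K s in \<open>auto simp: power_divide\<close>)
    also have "\<dots> \<le> (K * R) ^ m"
      using s K(1) by (intro power_mono mult_left_mono) (auto simp: R_def)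
    finally have 1: "\<bar>chi (\<lambda>s. 1 / f s) m s\<bar> \<le> (K * R) ^ m" .
    have "norm (D n s) = norm l * (1 / (f s)\<^sup>2) * (norm l ^ m / fact m * \<bar>chi (\<lambda>s. 1 / f s) m s\<bar>)"
      unfolding Suc D_Suc by (simp add: norm_mult norm_divide norm_power)
    also have "\<dots> \<le> norm l * K * (norm l ^ m / fact m * (K * R) ^ m)"
      using K(1) K(3)[OF s] 1 by (intro mult_mono) auto
    finally show ?thesis by (simp add: M_def Suc power_mult_distrib)
  qed (simp add: D_def M_def)
  have "summable (\<lambda>n. M (Suc n))"
    using summable_mult[OF summable_exp[of "norm l * (K * R)"], of "norm l * K"]
    unfolding M_def by (simp add: field_simps)
  then have summable_M: "summable M" by (simp add: summable_Suc_iff)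
  have "uniform_limit {a..b} (\<lambda>n s. \<Sum>i<n. D i s) (\<lambda>s. \<Sum>i. D i s) sequentially"
    by (rule Weierstrass_m_test[OF D_le summable_M])
  then have unif: "uniform_limit {a..b} (\<lambda>n s. \<Sum>i<n. D i s) g sequentially"
    unfolding uniform_limit_iff by (simp add: suminf_D)
  have "\<exists>h. \<forall>s\<in>{a..b}. (\<lambda>n. l ^ n / fact n * complex_of_real (chi f n s)) sums h s \<and>
      (h has_derivative (\<lambda>y. y *\<^sub>R g s)) (at s within {a..b})"
  proof (rule has_derivative_series[where f' = "\<lambda>n s y. y *\<^sub>R D n s"])
    fix n s assume s: "s \<in> {a..b}"
    have "(chi f n has_real_derivative real n * (chi (\<lambda>s. 1 / f s) (n - 1) s / (f s)\<^sup>2)) (at s)"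
    proof (cases n)
      case 0
      have "chi f 0 = (\<lambda>_. 1)" by auto
      then show ?thesis using 0 by simp
    next
      case (Suc m)
      then show ?thesis using chi_Suc_has_real_derivative[of s m] s ab by auto
    qed
    then have "((\<lambda>s. complex_of_real (chi f n s)) has_vector_derivative
        complex_of_real (real n * (chi (\<lambda>s. 1 / f s) (n - 1) s / (f s)\<^sup>2))) (at s)"
      by (intro has_vector_derivative_of_real) (simp add: has_real_derivative_iff_has_vector_derivative)
    then have "((\<lambda>s. l ^ n / fact n * complex_of_real (chi f n s)) has_vector_derivative D n s) (at s)"
      unfolding D_def by (rule has_vector_derivative_mult_right)
    then show "((\<lambda>s. l ^ n / fact n * complex_of_real (chi f n s)) has_derivative (\<lambda>y. y *\<^sub>R D n s)) (at s within {a..b})"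
      unfolding has_vector_derivative_def by (rule has_derivative_at_withinI)
  next
    fix e :: real assume e: "e > 0"
    have "\<forall>\<^sub>F n in sequentially. \<forall>s\<in>{a..b}. norm ((\<Sum>i<n. D i s) - g s) < e"
      using unif e unfolding uniform_limit_iff dist_norm by blast
    then show "\<forall>\<^sub>F n in sequentially. \<forall>s\<in>{a..b}. \<forall>y. norm ((\<Sum>i<n. y *\<^sub>R D i s) - y *\<^sub>R g s) \<le> e * norm y"
    proof (rule eventually_mono, intro ballI allI)
      fix n s and y :: real assume n: "\<forall>s\<in>{a..b}. norm ((\<Sum>i<n. D i s) - g s) < e" and s: "s \<in> {a..b}"
      have "norm ((\<Sum>i<n. y *\<^sub>R D i s) - y *\<^sub>R g s) = \<bar>y\<bar> * norm ((\<Sum>i<n. D i s) - g s)"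
        by (simp flip: scaleR_sum_right scaleR_diff_right)
      also have "\<dots> \<le> \<bar>y\<bar> * e" using n s by (intro mult_left_mono) (auto intro: less_imp_le)
      finally show "norm ((\<Sum>i<n. y *\<^sub>R D i s) - y *\<^sub>R g s) \<le> e * norm y" by (simp add: mult.commute)
    qed
  next
    show "(\<lambda>n. l ^ n / fact n * complex_of_real (chi f n z)) sums spps f l z"
      unfolding spps_def by (intro summable_sums summable_norm_cancel[OF spps_summable[OF assms]])
    show "z \<in> {a..b}" using ab by auto
  qed simp
  then obtain h where h: "\<And>s. s \<in> {a..b} \<Longrightarrow> (\<lambda>n. l ^ n / fact n * complex_of_real (chi f n s)) sums h s"
      "\<And>s. s \<in> {a..b} \<Longrightarrow> (h has_derivative (\<lambda>y. y *\<^sub>R g s)) (at s within {a..b})"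
    by blast
  have "(h has_vector_derivative g z) (at z)"
    using h(2)[of z] ab by (simp add: has_vector_derivative_def at_within_Icc_at)
  then show ?thesis
    unfolding g_def[symmetric]
    by (rule has_vector_derivative_transform_within_open[of _ _ _ "{a<..<b}"])
       (use ab h(1) in \<open>auto simp: spps_def sums_iff\<close>)
qed

section \<open>Legendre polynomials at 1 and the Bessel series of \<open>an\<close>\<close>

lemma sum_legendre_coeff: "(\<Sum>k=0..n. legendre_coeff k n) = 1"
proof -
  \<comment> \<open>Compare the coefficients of \<open>X ^ n\<close> in \<open>(1 - X\<^sup>2) ^ n / (1 - X) ^ (n + 1) = (1 + X) ^ n / (1 - X)\<close>.\<close>
  let ?X = "fps_X :: real fps"
  have G: "fps_nth (inverse ((1 - ?X) ^ Suc n)) m = real ((n + m) choose n)" for m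
    using one_minus_const_fps_X_neg_power'[of "Suc n" "1::real"]
    by (simp add: binomial_symmetric[of m "n + m"] del: power_Suc)
  have ones: "fps_nth (inverse (1 - ?X)) m = 1" for m by (simp add: fps_inverse_one_minus_fps_X)
  have "(1 - ?X\<^sup>2) ^ n * inverse ((1 - ?X) ^ Suc n) = (1 + ?X) ^ n * inverse (1 - ?X)"
  proof -
    have "(1 - ?X\<^sup>2) ^ n = (1 + ?X) ^ n * (1 - ?X) ^ n"
      by (simp add: power2_eq_square algebra_simps flip: power_mult_distrib)
    moreover have "inverse ((1 - ?X) ^ Suc n) = inverse ((1 - ?X) ^ n) * inverse (1 - ?X)"
      by (simp add: fps_inverse_mult mult.commute)
    moreover have "(1 - ?X) ^ n * inverse ((1 - ?X) ^ n) = 1"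
      by (rule inverse_mult_eq_1') (simp add: fps_power_zeroth)
    moreover have "(a * b) * (c * d) = a * (b * c) * d" for a b c d :: "real fps"
      by (simp only: mult_ac)
    ultimately show ?thesis by (simp only: mult_1_right)
  qed
  then have eq: "fps_nth ((1 - ?X\<^sup>2) ^ n * inverse ((1 - ?X) ^ Suc n)) n = fps_nth ((1 + ?X) ^ n * inverse (1 - ?X)) n"
    by simp
  have "(1 + ?X) ^ n = (\<Sum>j\<le>n. fps_const (real (n choose j)) * ?X ^ j)"
    using binomial_ring[of ?X 1 n] by (simp add: add.commute fps_of_nat)
  then have "fps_nth ((1 + ?X) ^ n * inverse (1 - ?X)) n = (\<Sum>j\<le>n. fps_nth (fps_const (real (n choose j)) * (?X ^ j * inverse (1 - ?X))) n)"
    by (simp add: sum_distrib_right fps_sum_nth mult.assoc)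
  also have "\<dots> = (\<Sum>j\<le>n. real (n choose j))"
    by (intro sum.cong) (auto simp: fps_X_power_mult_nth ones)
  also have "\<dots> = 2 ^ n"
    unfolding of_nat_sum[symmetric] choose_row_sum by simp
  finally have rhs: "fps_nth ((1 + ?X) ^ n * inverse (1 - ?X)) n = 2 ^ n" .
  have "(1 - ?X\<^sup>2) ^ n = (\<Sum>q\<le>n. fps_const ((-1) ^ q * real (n choose q)) * ?X ^ (2 * q))"
  proof -
    have "(1 - ?X\<^sup>2) ^ n = (- ?X\<^sup>2 + 1) ^ n" by simp
    also have "\<dots> = (\<Sum>q\<le>n. of_nat (n choose q) * (- ?X\<^sup>2) ^ q)"
      by (subst binomial_ring) simp
    also have "\<dots> = (\<Sum>q\<le>n. fps_const ((-1) ^ q * real (n choose q)) * ?X ^ (2 * q))"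
    proof (rule sum.cong)
      fix q
      have "(- ?X\<^sup>2) ^ q = fps_const ((-1) ^ q) * ?X ^ (2 * q)"
        by (cases "even q") (simp_all add: power_mult flip: fps_const_neg)
      then show "of_nat (n choose q) * (- ?X\<^sup>2) ^ q = fps_const ((-1) ^ q * real (n choose q)) * ?X ^ (2 * q)"
        by (simp add: fps_of_nat[symmetric] mult_ac flip: fps_const_mult)
    qed simp
    finally show ?thesis .
  qed
  then have "fps_nth ((1 - ?X\<^sup>2) ^ n * inverse ((1 - ?X) ^ Suc n)) n =
      (\<Sum>q\<le>n. fps_nth (fps_const ((-1) ^ q * real (n choose q)) * (?X ^ (2 * q) * inverse ((1 - ?X) ^ Suc n))) n)"
    by (simp add: sum_distrib_right fps_sum_nth mult.assoc)
  also have "\<dots> = (\<Sum>q\<le>n. if 2 * q \<le> n then (-1) ^ q * real (n choose q) * real ((n + (n - 2 * q)) choose n) else 0)"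
    by (intro sum.cong) (auto simp: fps_X_power_mult_nth G simp del: power_Suc)
  also have "\<dots> = (\<Sum>q | 2 * q \<le> n. (-1) ^ q * real (n choose q) * real ((n + (n - 2 * q)) choose n))"
    by (rule sum.mono_neutral_cong_right) auto
  \<comment> \<open>Substituting \<open>k = n - 2 * q\<close> turns the summands into
    \<open>2 ^ n\<close> times Legendre coefficients.\<close>
  also have "\<dots> = (\<Sum>k | k \<le> n \<and> even (n - k). (-1) ^ ((n - k) div 2) * real (n choose ((n - k) div 2)) * real ((n + k) choose n))"
    by (rule sum.reindex_bij_witness[of _ "\<lambda>k. (n - k) div 2" "\<lambda>q. n - 2 * q"]) auto
  also have "\<dots> = (\<Sum>k=0..n. 2 ^ n * legendre_coeff k n)"
    by (rule sum.mono_neutral_cong_left) (auto simp: legendre_coeff_def)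
  finally have "(\<Sum>k=0..n. 2 ^ n * legendre_coeff k n) = 2 ^ n" using rhs eq by simp
  then show ?thesis by (simp flip: sum_distrib_left)
qed

text \<open>Half the difference of two Neumann expansions: one with
  \<open>d k = phi f k z / z ^ k\<close>, giving \<open>f\<close> times the spectral series, and one
  with \<open>d k = 1\<close>, giving the free plane wave. The latter accounts for the
  \<open>- 1\<close> in \<open>an\<close>.\<close>

lemma an_bessel_sums:
  assumes "weight S f" "z \<in> S" "z \<noteq> 0"
  shows "(\<lambda>n. complex_of_real (an f n z) * exp (complex_of_real (real n * pi / 2) * \<i>) *
            complex_of_real (sph_bessel n (\<kappa> * z)))
         sums ((complex_of_real (f z) * spps f (\<i> * complex_of_real \<kappa>) z - exp (\<i> * complex_of_real (\<kappa> * z))) / 2)"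
proof -
  define w where "w = \<kappa> * z"
  define d where "d k = phi f k z / z ^ k" for k
  \<comment> \<open>The powers of \<open>z\<close> in \<open>w ^ k\<close> and in \<open>d k\<close>
    cancel, so summability reduces to that of the spectral series.\<close>
  have tm: "\<bar>w\<bar> ^ k * \<bar>d k\<bar> / fact k = \<bar>f z\<bar> * norm ((\<i> * complex_of_real \<kappa>) ^ k / fact k * complex_of_real (chi f k z))" for k
    using assms(3) by (simp add: w_def d_def phi_eq_chi norm_mult norm_divide norm_power abs_mult power_mult_distrib power_abs)
  have "summable (\<lambda>k. \<bar>w\<bar> ^ k * \<bar>d k\<bar> / fact k)"
    unfolding tm by (intro summable_mult spps_summable[OF assms(1,2)])
  note 1 = neumann_series[OF this]
  have "(\<Sum>k. (\<i> * complex_of_real w) ^ k * complex_of_real (d k) / fact k) =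
     (\<Sum>k. complex_of_real (f z) * ((\<i> * complex_of_real \<kappa>) ^ k / fact k * complex_of_real (chi f k z)))"
    using assms(3) by (intro arg_cong[of _ _ suminf] ext) (simp add: w_def d_def phi_eq_chi power_mult_distrib field_simps)
  also have "\<dots> = complex_of_real (f z) * spps f (\<i> * complex_of_real \<kappa>) z"
    unfolding spps_def by (intro suminf_mult summable_norm_cancel[OF spps_summable[OF assms(1,2)]])
  finally have s1: "(\<Sum>k. (\<i> * complex_of_real w) ^ k * complex_of_real (d k) / fact k) =
     complex_of_real (f z) * spps f (\<i> * complex_of_real \<kappa>) z" .
  \<comment> \<open>The choice \<open>d k = 1\<close> evaluates the expansion at
    \<open>y = 1\<close>, where each Legendre polynomial equals 1.\<close>
  have "summable (\<lambda>k. \<bar>w\<bar> ^ k * \<bar>1::real\<bar> / fact k)"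
    using summable_exp[of "\<bar>w\<bar>"] by (simp add: field_simps)
  note 2 = neumann_series[OF this]
  have s2: "(\<Sum>k. (\<i> * complex_of_real w) ^ k * complex_of_real 1 / fact k) = exp (\<i> * complex_of_real w)"
    unfolding exp_def by (simp add: scaleR_conv_of_real field_simps)
  have i: "exp (complex_of_real (real n * pi / 2) * \<i>) = \<i> ^ n" for n
  proof -
    have "exp (complex_of_real (real n * pi / 2) * \<i>) = exp (of_nat n * (\<i> * complex_of_real (pi / 2)))"
      by (simp add: field_simps)
    also have "\<dots> = \<i> ^ n" unfolding exp_of_nat_mult cis_conv_exp[symmetric] cis_pi_half ..
    finally show ?thesis .
  qed
  have "(\<lambda>n. (\<i> ^ n * complex_of_real ((2 * real n + 1) * sph_bessel n w * (\<Sum>k=0..n. legendre_coeff k n * d k)) -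
      \<i> ^ n * complex_of_real ((2 * real n + 1) * sph_bessel n w * (\<Sum>k=0..n. legendre_coeff k n * 1))) / 2)
     sums ((complex_of_real (f z) * spps f (\<i> * complex_of_real \<kappa>) z - exp (\<i> * complex_of_real w)) / 2)"
    using sums_diff[OF 1[unfolded s1] 2[unfolded s2], THEN sums_divide, of 2] .
  moreover have "(\<i> ^ n * complex_of_real ((2 * real n + 1) * sph_bessel n w * (\<Sum>k=0..n. legendre_coeff k n * d k)) -
      \<i> ^ n * complex_of_real ((2 * real n + 1) * sph_bessel n w * (\<Sum>k=0..n. legendre_coeff k n * 1))) / 2 =
      complex_of_real (an f n z) * exp (complex_of_real (real n * pi / 2) * \<i>) * complex_of_real (sph_bessel n w)" for n
  proof -
    obtain L where L: "(\<Sum>k=0..n. legendre_coeff k n * d k) = L" by blast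
    have an: "an f n z = (2 * real n + 1) / 2 * ((\<Sum>k=0..n. legendre_coeff k n * d k) - 1)"
      by (simp add: an_def d_def)
    show ?thesis
      unfolding i mult_1_right sum_legendre_coeff an L by (simp add: field_simps)
  qed
  ultimately show ?thesis by (simp add: w_def)
qed

lemma sph_bessel_uminus: "sph_bessel n (- w) = (-1) ^ n * sph_bessel n w"
  unfolding sph_bessel_def by (simp add: power_minus[of w n])

text \<open>The sign \<open>(-1) ^ n\<close> is the parity of \<open>j_n\<close>, so this is the
  previous series at \<open>- \<kappa>\<close>.\<close>

lemma an_bessel_alternating_sums:
  assumes "weight S f" "z \<in> S" "z \<noteq> 0"
  shows "(\<lambda>n. (-1) ^ n * complex_of_real (an f n z) * exp (complex_of_real (real n * pi / 2) * \<i>) *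
            complex_of_real (sph_bessel n (\<kappa> * z)))
         sums ((complex_of_real (f z) * spps f (- \<i> * complex_of_real \<kappa>) z - exp (- \<i> * complex_of_real (\<kappa> * z))) / 2)"
  using an_bessel_sums[OF assms, of "- \<kappa>"] by (simp add: sph_bessel_uminus mult_ac)

section \<open>Uniqueness along characteristics\<close>

text \<open>Existence of the \<open>x\<close>-derivative at the point together with a continuous
  \<open>t\<close>-derivative yields a total derivative, as the chain rule along a curve
  requires.\<close>

lemma has_derivative_of_partials:
  fixes P :: "real \<Rightarrow> real \<Rightarrow> 'a::real_normed_vector"
  assumes "((\<lambda>y. P y t) has_vector_derivative Px) (at x)"
    and "\<And>x t. (P x has_vector_derivative Pt x t) (at t)"
    and "continuous_on UNIV (\<lambda>p. Pt (fst p) (snd p))"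
  shows "((\<lambda>p. P (fst p) (snd p)) has_derivative (\<lambda>h. fst h *\<^sub>R Px + snd h *\<^sub>R Pt x t)) (at (x, t))"
proof -
  have "((\<lambda>(x, t). P x t) has_derivative (\<lambda>(h, k). h *\<^sub>R Px + blinfun_scaleR_left (Pt x t) k)) (at (x, t) within UNIV \<times> UNIV)"
  proof (rule has_derivative_partialsI)
    show "((\<lambda>x. P x t) has_derivative (\<lambda>h. h *\<^sub>R Px)) (at x)"
      using assms(1) by (simp add: has_vector_derivative_def)
    show "(P x has_derivative blinfun_apply (blinfun_scaleR_left (Pt x t))) (at t)" for x t
      using assms(2) by (simp add: has_vector_derivative_def)
    show "continuous (at (x, t) within UNIV \<times> UNIV) (\<lambda>(x, t). blinfun_scaleR_left (Pt x t))"
      using bounded_linear.continuous_on[OF bounded_linear_blinfun_scaleR_left assms(3)]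
      by (simp add: continuous_on_eq_continuous_at case_prod_unfold)
  qed auto
  then show ?thesis by (simp add: case_prod_unfold)
qed

lemma characteristic_has_vector_derivative:
  fixes P :: "real \<Rightarrow> real \<Rightarrow> 'a::real_normed_vector"
  assumes "((\<lambda>y. P y (g s)) has_vector_derivative Px) (at s)"
    and "\<And>x t. (P x has_vector_derivative Pt x t) (at t)"
    and "continuous_on UNIV (\<lambda>p. Pt (fst p) (snd p))"
    and g: "(g has_real_derivative g') (at s)"
  shows "((\<lambda>s. P s (g s)) has_vector_derivative Px + g' *\<^sub>R Pt s (g s)) (at s)"
proof -
  have "((\<lambda>s. (s, g s)) has_derivative (\<lambda>h. (h, g' * h))) (at s)"
    using g by (intro has_derivative_Pair) (auto simp: has_field_derivative_def)
  from has_derivative_compose[OF this has_derivative_of_partials[OF assms(1-3)]]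
  show ?thesis by (simp add: has_vector_derivative_def algebra_simps)
qed

text \<open>On a curve with \<open>t + X\<close> constant the \<open>Pt\<close> terms cancel and the
  derivative of \<open>P\<close> is \<open>r\<close> times \<open>Q\<close>; with
  \<open>t - X\<close> constant the roles are exchanged. Both curves reach \<open>x = 0\<close>,
  where the data vanish, so each function is an integral of the other.\<close>

lemma riemann_invariants_zero:
  fixes P Q Pt Qt :: "real \<Rightarrow> real \<Rightarrow> complex" and X X' r :: "real \<Rightarrow> real"
  assumes Px: "\<And>x t. ((\<lambda>y. P y t) has_vector_derivative X' x *\<^sub>R Pt x t + r x *\<^sub>R Q x t) (at x)"
    and Qx: "\<And>x t. ((\<lambda>y. Q y t) has_vector_derivative - X' x *\<^sub>R Qt x t + r x *\<^sub>R P x t) (at x)"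
    and Pt: "\<And>x t. (P x has_vector_derivative Pt x t) (at t)"
    and Qt: "\<And>x t. (Q x has_vector_derivative Qt x t) (at t)"
    and cP: "continuous_on UNIV (\<lambda>p. Pt (fst p) (snd p))"
    and cQ: "continuous_on UNIV (\<lambda>p. Qt (fst p) (snd p))"
    and X: "\<And>x. (X has_real_derivative X' x) (at x)" "mono X"
    and r: "continuous_on UNIV r"
    and init: "\<And>t. P 0 t = 0" "\<And>t. Q 0 t = 0"
  shows "P x0 t0 = 0 \<and> Q x0 t0 = 0"
proof -
  define I where "I = closed_segment 0 x0"
  define T where "T = \<bar>X x0 - X 0\<bar>"
  have contP: "continuous_on UNIV (\<lambda>p. P (fst p) (snd p))"
    and contQ: "continuous_on UNIV (\<lambda>p. Q (fst p) (snd p))"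
    using has_derivative_of_partials[OF Px Pt cP, THEN has_derivative_continuous]
      has_derivative_of_partials[OF Qx Qt cQ, THEN has_derivative_continuous]
    by (auto simp: continuous_on_eq_continuous_at)
  \<comment> \<open>This rectangle contains the whole domain of dependence of
    \<open>(x0, t0)\<close>; its compactness yields the initial constant \<open>C\<close>.\<close>
  have comp: "compact (I \<times> cball t0 T)" by (simp add: I_def compact_Times)
  have "bounded ((\<lambda>p. P (fst p) (snd p)) ` (I \<times> cball t0 T))" "bounded ((\<lambda>p. Q (fst p) (snd p)) ` (I \<times> cball t0 T))"
    using contP contQ comp by (auto intro!: compact_imp_bounded compact_continuous_image intro: continuous_on_subset)
  then obtain C1 C2 where C1: "\<And>p. p \<in> I \<times> cball t0 T \<Longrightarrow> norm (P (fst p) (snd p)) \<le> C1"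
    and C2: "\<And>p. p \<in> I \<times> cball t0 T \<Longrightarrow> norm (Q (fst p) (snd p)) \<le> C2"
    unfolding bounded_iff by (metis (no_types, lifting) image_eqI)
  define C where "C = max C1 C2"
  have "bounded (r ` I)"
    using r by (auto intro!: compact_imp_bounded compact_continuous_image simp: I_def intro: continuous_on_subset)
  then obtain K where K: "\<And>x. x \<in> I \<Longrightarrow> \<bar>r x\<bar> \<le> K"
    unfolding bounded_iff by auto
  have K0: "K \<ge> 0" using K[of 0] by (auto simp: I_def intro: order_trans[OF abs_ge_zero])
  \<comment> \<open>By monotonicity the distances in \<open>X\<close> add up along the segment,
    which keeps both characteristics through a point of the domain of dependence inside it.\<close>
  have Xm: "\<bar>X x0 - X s\<bar> = \<bar>X x0 - X x\<bar> + \<bar>X x - X s\<bar>" if "x \<in> I" "s \<in> closed_segment 0 x" for x s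
  proof (cases "x0 \<ge> 0")
    case True
    then have "s \<le> x" "x \<le> x0" using that by (auto simp: I_def closed_segment_eq_real_ivl split: if_splits)
    then have "X s \<le> X x" "X x \<le> X x0" using X(2) by (auto dest: monoD)
    then show ?thesis by linarith
  next
    case False
    then have "x \<le> s" "x0 \<le> x" using that by (auto simp: I_def closed_segment_eq_real_ivl split: if_splits)
    then have "X x \<le> X s" "X x0 \<le> X x" using X(2) by (auto dest: monoD)
    then show ?thesis by linarith
  qed
  \<comment> \<open>The condition on \<open>t\<close> describes the triangle that shrinks to
    \<open>t = t0\<close> at \<open>x = x0\<close> and is widest at \<open>x = 0\<close>.\<close>
  have bound: "\<forall>x t. x \<in> I \<longrightarrow> \<bar>t - t0\<bar> \<le> \<bar>X x0 - X x\<bar> \<longrightarrow>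
      norm (P x t) \<le> C * (K * \<bar>x\<bar>) ^ n / fact n \<and> norm (Q x t) \<le> C * (K * \<bar>x\<bar>) ^ n / fact n" for n
  proof (induction n)
    case 0
    show ?case
    proof (intro allI impI)
      fix x t assume x: "x \<in> I" and t: "\<bar>t - t0\<bar> \<le> \<bar>X x0 - X x\<bar>"
      have "\<bar>X x0 - X x\<bar> \<le> T" using Xm[OF x, of 0] by (simp add: T_def)
      then have "(x, t) \<in> I \<times> cball t0 T" using x t by (auto simp: dist_real_def)
      then show "norm (P x t) \<le> C * (K * \<bar>x\<bar>) ^ 0 / fact 0 \<and> norm (Q x t) \<le> C * (K * \<bar>x\<bar>) ^ 0 / fact 0"
        using C1[of "(x, t)"] C2[of "(x, t)"] by (auto simp: C_def)
    qed
  next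
    case (Suc n)
    show ?case
    proof (intro allI impI)
      fix x t assume x: "x \<in> I" and t: "\<bar>t - t0\<bar> \<le> \<bar>X x0 - X x\<bar>"
      have sI: "s \<in> I" if "s \<in> closed_segment 0 x" for s
        using that x by (auto simp: I_def closed_segment_eq_real_ivl split: if_splits)
      \<comment> \<open>The form \<open>t + (X x - X x)\<close> exhibits both terms as values of
        \<open>s \<mapsto> P s (t + (X x - X s))\<close> at the endpoints \<open>x\<close> and
        0.\<close>
      have "norm (P x (t + (X x - X x)) - P 0 (t + (X x - X 0))) \<le> (K * (C * K ^ n / fact n)) * \<bar>x\<bar> ^ Suc n / real (Suc n)"
      proof (rule norm_diff_zero_le_power)
        fix s assume s: "s \<in> closed_segment 0 x"
        have "((\<lambda>s. P s (t + (X x - X s))) has_vector_derivative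
            (X' s *\<^sub>R Pt s (t + (X x - X s)) + r s *\<^sub>R Q s (t + (X x - X s))) + (- X' s) *\<^sub>R Pt s (t + (X x - X s))) (at s)"
          by (rule characteristic_has_vector_derivative[OF Px Pt cP]) (auto intro!: derivative_eq_intros X)
        then show "((\<lambda>s. P s (t + (X x - X s))) has_vector_derivative r s *\<^sub>R Q s (t + (X x - X s))) (at s)" by simp
        have "\<bar>t + (X x - X s) - t0\<bar> \<le> \<bar>X x0 - X s\<bar>" using Xm[OF x s] t by linarith
        then have "norm (Q s (t + (X x - X s))) \<le> C * (K * \<bar>s\<bar>) ^ n / fact n" using Suc sI[OF s] by blast
        then have "\<bar>r s\<bar> * norm (Q s (t + (X x - X s))) \<le> K * (C * (K * \<bar>s\<bar>) ^ n / fact n)"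
          using K[OF sI[OF s]] K0 by (intro mult_mono) auto
        then show "norm (r s *\<^sub>R Q s (t + (X x - X s))) \<le> K * (C * K ^ n / fact n) * \<bar>s\<bar> ^ n"
          by (simp add: power_mult_distrib mult_ac)
      qed
      moreover have "norm (Q x (t - (X x - X x)) - Q 0 (t - (X x - X 0))) \<le> (K * (C * K ^ n / fact n)) * \<bar>x\<bar> ^ Suc n / real (Suc n)"
      proof (rule norm_diff_zero_le_power)
        fix s assume s: "s \<in> closed_segment 0 x"
        have "((\<lambda>s. Q s (t - (X x - X s))) has_vector_derivative
            (- X' s *\<^sub>R Qt s (t - (X x - X s)) + r s *\<^sub>R P s (t - (X x - X s))) + X' s *\<^sub>R Qt s (t - (X x - X s))) (at s)"
          by (rule characteristic_has_vector_derivative[OF Qx Qt cQ]) (auto intro!: derivative_eq_intros X)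
        then show "((\<lambda>s. Q s (t - (X x - X s))) has_vector_derivative r s *\<^sub>R P s (t - (X x - X s))) (at s)" by simp
        have "\<bar>t - (X x - X s) - t0\<bar> \<le> \<bar>X x0 - X s\<bar>" using Xm[OF x s] t by linarith
        then have "norm (P s (t - (X x - X s))) \<le> C * (K * \<bar>s\<bar>) ^ n / fact n" using Suc sI[OF s] by blast
        then have "\<bar>r s\<bar> * norm (P s (t - (X x - X s))) \<le> K * (C * (K * \<bar>s\<bar>) ^ n / fact n)"
          using K[OF sI[OF s]] K0 by (intro mult_mono) auto
        then show "norm (r s *\<^sub>R P s (t - (X x - X s))) \<le> K * (C * K ^ n / fact n) * \<bar>s\<bar> ^ n"
          by (simp add: power_mult_distrib mult_ac)
      qed
      ultimately show "norm (P x t) \<le> C * (K * \<bar>x\<bar>) ^ Suc n / fact (Suc n) \<and> norm (Q x t) \<le> C * (K * \<bar>x\<bar>) ^ Suc n / fact (Suc n)"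
        by (simp add: init power_mult_distrib mult_ac del: of_nat_Suc)
    qed
  qed
  have "(\<lambda>n. (K * \<bar>x0\<bar>) ^ n / fact n) \<longlonglongrightarrow> 0"
    using summable_LIMSEQ_zero[OF summable_exp[of "K * \<bar>x0\<bar>"]] by (simp add: field_simps)
  from tendsto_mult_left[OF this, of C] have lim: "(\<lambda>n. C * (K * \<bar>x0\<bar>) ^ n / fact n) \<longlonglongrightarrow> 0" by simp
  have x0: "x0 \<in> I" by (simp add: I_def)
  have "norm (P x0 t0) \<le> 0"
    by (rule LIMSEQ_le_const[OF lim]) (use bound x0 in auto)
  moreover have "norm (Q x0 t0) \<le> 0"
    by (rule LIMSEQ_le_const[OF lim]) (use bound x0 in auto)
  ultimately show ?thesis by simp
qed

section \<open>The Maxwell system\<close>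

lemma maxwell_solution_zero: "maxwell_solution eps mu (\<lambda>x t. 0) (\<lambda>x t. 0)"
  unfolding maxwell_solution_def by (intro exI[of _ "\<lambda>x t. 0"]) simp

text \<open>The scalar serves two purposes: \<open>a = 1\<close> for sums of modes and
  \<open>a = -1\<close> for the difference of two solutions.\<close>

lemma maxwell_solution_linear:
  assumes "maxwell_solution eps mu E1 H1" "maxwell_solution eps mu E2 H2"
  shows "maxwell_solution eps mu (\<lambda>x t. E1 x t + a * E2 x t) (\<lambda>x t. H1 x t + a * H2 x t)"
proof -
  obtain Ex1 Et1 Hx1 Ht1 where
    1: "\<And>x t. ((\<lambda>y. E1 y t) has_vector_derivative Ex1 x t) (at x)"
       "\<And>x t. ((\<lambda>s. E1 x s) has_vector_derivative Et1 x t) (at t)"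
       "\<And>x t. ((\<lambda>y. H1 y t) has_vector_derivative Hx1 x t) (at x)"
       "\<And>x t. ((\<lambda>s. H1 x s) has_vector_derivative Ht1 x t) (at t)"
       "continuous_on UNIV (\<lambda>p. Ex1 (fst p) (snd p))" "continuous_on UNIV (\<lambda>p. Et1 (fst p) (snd p))"
       "continuous_on UNIV (\<lambda>p. Hx1 (fst p) (snd p))" "continuous_on UNIV (\<lambda>p. Ht1 (fst p) (snd p))"
       "\<And>x t. complex_of_real (eps x) * Et1 x t = \<i> * Hx1 x t"
       "\<And>x t. \<i> * Ex1 x t = - complex_of_real mu * Ht1 x t"
    using assms(1) unfolding maxwell_solution_def by blast
  obtain Ex2 Et2 Hx2 Ht2 where
    2: "\<And>x t. ((\<lambda>y. E2 y t) has_vector_derivative Ex2 x t) (at x)"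
       "\<And>x t. ((\<lambda>s. E2 x s) has_vector_derivative Et2 x t) (at t)"
       "\<And>x t. ((\<lambda>y. H2 y t) has_vector_derivative Hx2 x t) (at x)"
       "\<And>x t. ((\<lambda>s. H2 x s) has_vector_derivative Ht2 x t) (at t)"
       "continuous_on UNIV (\<lambda>p. Ex2 (fst p) (snd p))" "continuous_on UNIV (\<lambda>p. Et2 (fst p) (snd p))"
       "continuous_on UNIV (\<lambda>p. Hx2 (fst p) (snd p))" "continuous_on UNIV (\<lambda>p. Ht2 (fst p) (snd p))"
       "\<And>x t. complex_of_real (eps x) * Et2 x t = \<i> * Hx2 x t"
       "\<And>x t. \<i> * Ex2 x t = - complex_of_real mu * Ht2 x t"
    using assms(2) unfolding maxwell_solution_def by blast
  have eqs: "complex_of_real (eps x) * (Et1 x t + a * Et2 x t) = \<i> * (Hx1 x t + a * Hx2 x t)"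
      "\<i> * (Ex1 x t + a * Ex2 x t) = - complex_of_real mu * (Ht1 x t + a * Ht2 x t)" for x t
    using 1(9,10)[of x t] 2(9,10)[of x t] by (simp_all add: distrib_left mult.left_commute[of _ a])
  show ?thesis
    unfolding maxwell_solution_def
    by (rule exI[of _ "\<lambda>x t. Ex1 x t + a * Ex2 x t"], rule exI[of _ "\<lambda>x t. Et1 x t + a * Et2 x t"],
        rule exI[of _ "\<lambda>x t. Hx1 x t + a * Hx2 x t"], rule exI[of _ "\<lambda>x t. Ht1 x t + a * Ht2 x t"])
       (intro conjI allI has_vector_derivative_add has_vector_derivative_mult_right continuous_on_add
          continuous_on_mult_left 1 2 eqs)
qed

lemma maxwell_solution_sum:
  assumes "\<And>m. m \<in> I \<Longrightarrow> maxwell_solution eps mu (E m) (H m)"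
  shows "maxwell_solution eps mu (\<lambda>x t. \<Sum>m\<in>I. E m x t) (\<lambda>x t. \<Sum>m\<in>I. H m x t)"
  using assms
proof (induction I rule: infinite_finite_induct)
  case (insert m I)
  then have "maxwell_solution eps mu (\<lambda>x t. E m x t + 1 * (\<Sum>m\<in>I. E m x t)) (\<lambda>x t. H m x t + 1 * (\<Sum>m\<in>I. H m x t))"
    by (intro maxwell_solution_linear) auto
  with insert show ?case by simp
qed (simp_all add: maxwell_solution_zero)

section \<open>The travel time coordinate and the weight\<close>

locale medium =
  fixes eps :: "real \<Rightarrow> real" and mu :: real
  assumes eps_pos: "eps x > 0"
    and eps_cont: "continuous_on UNIV eps"
    and mu_pos: "mu > 0"
    and f_C1: "fT eps mu C1_differentiable_on range (xi eps mu)"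
begin

abbreviation "X \<equiv> xi eps mu"
abbreviation "f \<equiv> fT eps mu"
abbreviation "c0 \<equiv> cc eps mu 0"

lemma X_deriv: "(X has_real_derivative sqrt mu * sqrt (eps x)) (at x)"
proof -
  have "((\<lambda>y. oint 0 y (\<lambda>s. sqrt (eps s))) has_real_derivative sqrt (eps x)) (at x)"
    by (rule oint_0_has_real_derivative[of UNIV]) (auto intro!: continuous_intros eps_cont)
  then show ?thesis unfolding xi_def[abs_def] by (rule DERIV_cmult)
qed

lemma X_0 [simp]: "X 0 = 0"
  by (simp add: xi_def oint_def)

lemma X_strict_mono: "strict_mono X"
proof (rule strict_monoI)
  fix a b :: real assume "a < b"
  then show "X a < X b"
    by (rule DERIV_pos_imp_increasing) (use X_deriv eps_pos mu_pos in \<open>auto intro!: exI mult_pos_pos\<close>)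
qed

lemma X_inj: "inj X"
  using X_strict_mono by (rule strict_mono_imp_inj_on)

lemma X_ne_0: "x \<noteq> 0 \<Longrightarrow> X x \<noteq> 0"
  using X_inj X_0 by (metis injD)

lemma X_cont: "continuous_on UNIV X"
  using X_deriv DERIV_isCont continuous_at_imp_continuous_on by blast

lemma c_pos: "cc eps mu x > 0"
  using eps_pos mu_pos by (simp add: cc_def)

lemma f_X: "f (X x) = sqrt c0 / sqrt (cc eps mu x)"
  by (simp add: fT_def inv_f_f[OF X_inj])

lemma f_X_pos: "f (X x) > 0"
  using c_pos by (simp add: f_X)

text \<open>Since \<open>1 / c\<close> is the derivative of \<open>X\<close>, the squared weight is
  \<open>c0\<close> times that derivative. This identity removes square roots when passing from
  \<open>xi\<close> back to \<open>x\<close>.\<close>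

lemma f_X_sq: "(f (X x))\<^sup>2 = c0 * (sqrt mu * sqrt (eps x))"
  using c_pos[of x] c_pos[of 0] eps_pos[of x] mu_pos
  by (simp add: f_X power_divide cc_def real_sqrt_mult)

lemma weight_f: "weight (range X) f"
proof
  \<comment> \<open>A continuous injection of the line is an open map, so the range is open;
    connectedness then gives convexity.\<close>
  have "\<forall>T. open T \<and> T \<subseteq> UNIV \<longrightarrow> open (X ` T)"
    using X_inj X_cont injective_eq_1d_open_map_UNIV[of UNIV X] by (simp add: is_interval_univ)
  then show "open (range X)" by simp
  have "connected (range X)" using X_cont by (intro connected_continuous_image) auto
  then show "convex (range X)" by (metis is_interval_connected_1 is_interval_convex_1)
  show "0 \<in> range X" using X_0 by (metis rangeI)
  show "continuous_on (range X) f"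
    using f_C1 by (rule C1_differentiable_imp_continuous_on)
  show "s \<in> range X \<Longrightarrow> f s > 0" for s using f_X_pos by auto
qed

lemma f_X_C1:
  obtains g' where "\<And>x. ((\<lambda>x. f (X x)) has_real_derivative g' x) (at x)" "continuous_on UNIV g'"
proof -
  obtain D where D: "\<And>z. z \<in> range X \<Longrightarrow> (f has_vector_derivative D z) (at z)" "continuous_on (range X) D"
    using f_C1 unfolding C1_differentiable_on_def by blast
  show ?thesis
  proof
    show "((\<lambda>x. f (X x)) has_real_derivative D (X x) * (sqrt mu * sqrt (eps x))) (at x)" for x
      using D(1)[of "X x"] by (intro DERIV_chain2[OF _ X_deriv]) (simp add: has_real_derivative_iff_has_vector_derivative)
    show "continuous_on UNIV (\<lambda>x. D (X x) * (sqrt mu * sqrt (eps x)))"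
      using D(2) by (intro continuous_intros continuous_on_compose2[OF D(2) X_cont] eps_cont) auto
  qed
qed

section \<open>Uniqueness for the Maxwell system\<close>

text \<open>Scaling \<open>E\<close> by \<open>f\<close> and \<open>H\<close> by
  \<open>1 / f\<close> diagonalises the principal part. Differentiating \<open>f\<close> and
  \<open>1 / f\<close> produces terms of opposite sign, which combine to the logarithmic derivative
  of \<open>f\<close> times the opposite invariant.\<close>

lemma maxwell_solution_unique_zero:
  assumes sol: "maxwell_solution eps mu E H" and init: "\<And>t. E 0 t = 0" "\<And>t. H 0 t = 0"
  shows "E x t = 0 \<and> H x t = 0"
proof -
  from sol obtain Ex Et Hx Ht where
       Ex: "\<And>x t. ((\<lambda>y. E y t) has_vector_derivative Ex x t) (at x)"
       and Et: "\<And>x t. ((\<lambda>s. E x s) has_vector_derivative Et x t) (at t)"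
       and Hx: "\<And>x t. ((\<lambda>y. H y t) has_vector_derivative Hx x t) (at x)"
       and Ht: "\<And>x t. ((\<lambda>s. H x s) has_vector_derivative Ht x t) (at t)"
       and cEt: "continuous_on UNIV (\<lambda>p. Et (fst p) (snd p))"
       and cHt: "continuous_on UNIV (\<lambda>p. Ht (fst p) (snd p))"
       and eq1: "\<And>x t. complex_of_real (eps x) * Et x t = \<i> * Hx x t"
       and eq2: "\<And>x t. \<i> * Ex x t = - complex_of_real mu * Ht x t"
    unfolding maxwell_solution_def by blast
  have Hx_eq: "Hx x t = - \<i> * complex_of_real (eps x) * Et x t" for x t
    using arg_cong[OF eq1[of x t], of "\<lambda>z. - \<i> * z"] by (simp add: mult.assoc)
  have Ex_eq: "Ex x t = \<i> * complex_of_real mu * Ht x t" for x t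
    using arg_cong[OF eq2[of x t], of "\<lambda>z. - \<i> * z"] by simp
  obtain g' where g': "\<And>x. ((\<lambda>x. f (X x)) has_real_derivative g' x) (at x)" "continuous_on UNIV g'"
    using f_X_C1 by blast
  define g where "g x = complex_of_real (f (X x))" for x
  define X' where "X' x = sqrt mu * sqrt (eps x)" for x
  define a where "a = complex_of_real (c0 * mu)"
  have g_deriv: "(g has_vector_derivative complex_of_real (g' x)) (at x)" for x
    unfolding g_def using g'(1) by (intro has_vector_derivative_of_real) (simp add: has_real_derivative_iff_has_vector_derivative)
  have "((\<lambda>x. 1 / f (X x)) has_real_derivative - g' x / (f (X x))\<^sup>2) (at x)" for x
    using f_X_pos[of x] by (auto intro!: derivative_eq_intros g'(1) simp: power2_eq_square)
  then have "((\<lambda>x. complex_of_real (1 / f (X x))) has_vector_derivative complex_of_real (- g' x / (f (X x))\<^sup>2)) (at x)" for x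
    by (intro has_vector_derivative_of_real) (simp add: has_real_derivative_iff_has_vector_derivative)
  then have gi_deriv: "((\<lambda>x. 1 / g x) has_vector_derivative - complex_of_real (g' x) / (g x)\<^sup>2) (at x)" for x
    by (simp add: g_def)
  have g0: "g x \<noteq> 0" for x using f_X_pos[of x] by (simp add: g_def)
  have X'_g: "complex_of_real (X' x) * complex_of_real c0 = (g x)\<^sup>2" for x
    using f_X_sq[of x] by (simp add: g_def X'_def mult.commute flip: of_real_power of_real_mult)
  have X'_sq: "complex_of_real (X' x) * complex_of_real (X' x) = complex_of_real (eps x) * complex_of_real mu" for x
  proof -
    have "X' x * X' x = (sqrt mu * sqrt mu) * (sqrt (eps x) * sqrt (eps x))" by (simp only: X'_def mult_ac)
    also have "\<dots> = eps x * mu" using eps_pos[of x] mu_pos by simp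
    finally show ?thesis by (metis of_real_mult)
  qed
  have c0: "c0 \<noteq> 0" using c_pos[of 0] by simp
  have cont_g: "continuous_on UNIV g"
    by (intro continuous_at_imp_continuous_on ballI) (rule has_vector_derivative_continuous[OF g_deriv])
  \<comment> \<open>The complex sign \<open>s\<close> treats both invariants at once; only
    \<open>s = 1\<close> and \<open>s = -1\<close> occur, and \<open>Re s\<close> is the real sign
    of the transport term.\<close>
  define P where "P s x t = g x * E x t + s * \<i> * (a * (1 / g x * H x t))" for s x t
  define Pt where "Pt s x t = g x * Et x t + s * \<i> * (a * (1 / g x * Ht x t))" for s x t
  have Pt: "(P s x has_vector_derivative Pt s x t) (at t)" for s x t
    unfolding P_def[abs_def] Pt_def by (intro has_vector_derivative_add has_vector_derivative_mult_right Et Ht)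
  have cPt: "continuous_on UNIV (\<lambda>p. Pt s (fst p) (snd p))" for s
  proof -
    have "continuous_on UNIV (\<lambda>p::real \<times> real. g (fst p))"
      by (rule continuous_on_compose2[OF cont_g continuous_on_fst]) (auto intro: continuous_on_id)
    then show ?thesis unfolding Pt_def by (intro continuous_intros cEt cHt) (auto simp: g0)
  qed
  have Px: "((\<lambda>y. P s y t) has_vector_derivative (Re s * X' x) *\<^sub>R Pt s x t + (g' x / f (X x)) *\<^sub>R P (- s) x t) (at x)"
    if s: "s = 1 \<or> s = -1" for s x t
  proof -
    have "((\<lambda>y. P s y t) has_vector_derivative (g x * Ex x t + complex_of_real (g' x) * E x t) +
        s * \<i> * (a * (1 / g x * Hx x t + (- complex_of_real (g' x) / (g x)\<^sup>2) * H x t))) (at x)"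
      unfolding P_def
      by (intro has_vector_derivative_add has_vector_derivative_mult_right has_vector_derivative_mult g_deriv gi_deriv Ex Hx)
    moreover have "(g x * Ex x t + complex_of_real (g' x) * E x t) +
        s * \<i> * (a * (1 / g x * Hx x t + (- complex_of_real (g' x) / (g x)\<^sup>2) * H x t)) =
       (Re s * X' x) *\<^sub>R Pt s x t + (g' x / f (X x)) *\<^sub>R P (- s) x t"
    proof -
      \<comment> \<open>\<open>e\<close> and \<open>m\<close> match the coefficients of
        \<open>Et\<close> and \<open>Ht\<close> in the transport term with those that the Maxwell
        equations give for \<open>Hx\<close> and \<open>Ex\<close>.\<close>
      have e: "a * complex_of_real (eps x) / g x = complex_of_real (X' x) * g x"
      proof -
        have "a * complex_of_real (eps x) = complex_of_real c0 * (complex_of_real (X' x) * complex_of_real (X' x))"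
          unfolding X'_sq a_def by simp
        also have "\<dots> = complex_of_real (X' x) * (g x)\<^sup>2" unfolding X'_g[symmetric] by simp
        finally show ?thesis using g0[of x] by (simp add: field_simps power2_eq_square)
      qed
      have m: "complex_of_real (X' x) * a / g x = complex_of_real mu * g x"
      proof -
        have "complex_of_real (X' x) * a = complex_of_real mu * (g x)\<^sup>2"
          unfolding X'_g[symmetric] a_def by simp
        then show ?thesis using g0[of x] by (simp add: field_simps power2_eq_square)
      qed
      have ss: "complex_of_real (Re s) = s" "s * s = 1" using s by auto
      have "(Re s * X' x) *\<^sub>R Pt s x t = s * (complex_of_real (X' x) * g x) * Et x t +
          (s * s) * \<i> * (complex_of_real (X' x) * a / g x) * Ht x t"
        unfolding Pt_def scaleR_conv_of_real of_real_mult ss(1) by (simp add: algebra_simps)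
      also have "\<dots> = s * (a * complex_of_real (eps x) / g x) * Et x t + \<i> * (complex_of_real mu * g x) * Ht x t"
        unfolding e m ss(2) by simp
      also have "\<dots> = g x * Ex x t + s * \<i> * (a * (1 / g x * Hx x t))"
        unfolding Ex_eq Hx_eq by (simp add: algebra_simps)
      finally have 1: "(Re s * X' x) *\<^sub>R Pt s x t = g x * Ex x t + s * \<i> * (a * (1 / g x * Hx x t))" .
      have 2: "(g' x / f (X x)) *\<^sub>R P (- s) x t =
          complex_of_real (g' x) * E x t - s * \<i> * (a * (complex_of_real (g' x) / (g x)\<^sup>2 * H x t))"
        unfolding P_def scaleR_conv_of_real of_real_divide g_def[symmetric]
        using g0[of x] by (simp add: field_simps power2_eq_square)
      show ?thesis unfolding 1 2 by (simp add: algebra_simps)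
    qed
    ultimately show ?thesis by simp
  qed
  have P0: "P s 0 t = 0" for s t by (simp add: P_def init)
  have "P 1 x t = 0 \<and> P (-1) x t = 0"
  proof (rule riemann_invariants_zero[where X = X and X' = X' and r = "\<lambda>x. g' x / f (X x)"])
    show "((\<lambda>y. P 1 y t) has_vector_derivative X' x *\<^sub>R Pt 1 x t + (g' x / f (X x)) *\<^sub>R P (-1) x t) (at x)" for x t
      using Px[of 1 t x] by simp
    show "((\<lambda>y. P (-1) y t) has_vector_derivative - X' x *\<^sub>R Pt (-1) x t + (g' x / f (X x)) *\<^sub>R P 1 x t) (at x)" for x t
      using Px[of "-1" t x] by simp
    show "(X has_real_derivative X' x) (at x)" for x using X_deriv by (simp add: X'_def)
    show "mono X" using X_strict_mono by (rule strict_mono_mono)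
    have "continuous_on UNIV (\<lambda>x. f (X x))"
      using g'(1) DERIV_isCont continuous_at_imp_continuous_on by blast
    then show "continuous_on UNIV (\<lambda>x. g' x / f (X x))"
      using f_X_pos by (intro continuous_intros g'(2)) (auto simp: less_imp_neq[symmetric])
  qed (use Pt cPt P0 in auto)
  \<comment> \<open>Sum and difference of the two invariants are nonzero multiples of
    \<open>E\<close> and of \<open>H\<close>.\<close>
  then have "P 1 x t + P (-1) x t = 0" "P 1 x t - P (-1) x t = 0" by simp_all
  then show ?thesis using g0[of x] c0 mu_pos by (simp add: P_def a_def)
qed

lemma maxwell_solution_unique:
  assumes "maxwell_solution eps mu E1 H1" "maxwell_solution eps mu E2 H2"
    and "\<And>t. E1 0 t = E2 0 t" "\<And>t. H1 0 t = H2 0 t"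
  shows "E1 x t = E2 x t \<and> H1 x t = H2 x t"
proof -
  have "maxwell_solution eps mu (\<lambda>x t. E1 x t + (-1) * E2 x t) (\<lambda>x t. H1 x t + (-1) * H2 x t)"
    by (rule maxwell_solution_linear[OF assms(1,2)])
  from maxwell_solution_unique_zero[OF this, of x t] assms(3,4) show ?thesis by simp
qed

section \<open>Single-frequency solutions\<close>

abbreviation "A l x \<equiv> spps f l (X x)"
abbreviation "B l x \<equiv> spps (\<lambda>s. 1 / f s) l (X x)"

text \<open>The chain rule factor \<open>X'\<close> over \<open>f^2\<close> is the constant
  \<open>1 / c0\<close>.\<close>

lemma A_deriv: "(A l has_vector_derivative l / complex_of_real c0 * B l x) (at x)"
proof -
  have "((spps f l \<circ> X) has_vector_derivative (sqrt mu * sqrt (eps x)) *\<^sub>R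
      (l * spps (\<lambda>s. 1 / f s) l (X x) / complex_of_real ((f (X x))\<^sup>2))) (at x)"
    by (intro vector_diff_chain_at spps_has_vector_derivative[OF weight_f])
       (use X_deriv in \<open>auto simp: has_real_derivative_iff_has_vector_derivative\<close>)
  moreover have "sqrt mu * sqrt (eps x) \<noteq> 0" using eps_pos[of x] mu_pos by simp
  ultimately show ?thesis
    unfolding f_X_sq scaleR_conv_of_real by (simp add: o_def)
qed

text \<open>Here the weight is inverted, and \<open>X'\<close> times \<open>f^2\<close> is
  \<open>c0 * mu * eps x\<close>.\<close>

lemma B_deriv: "(B l has_vector_derivative l * complex_of_real (c0 * mu * eps x) * A l x) (at x)"
proof -
  have w: "weight (range X) (\<lambda>s. 1 / f s)" by (rule weight_inverse[OF weight_f])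
  have "((spps (\<lambda>s. 1 / f s) l \<circ> X) has_vector_derivative (sqrt mu * sqrt (eps x)) *\<^sub>R
      (l * spps (\<lambda>s. 1 / (1 / f s)) l (X x) / complex_of_real ((1 / f (X x))\<^sup>2))) (at x)"
    by (intro vector_diff_chain_at spps_has_vector_derivative[OF w])
       (use X_deriv in \<open>auto simp: has_real_derivative_iff_has_vector_derivative\<close>)
  moreover have "(sqrt mu * sqrt (eps x)) *\<^sub>R
      (l * spps (\<lambda>s. 1 / (1 / f s)) l (X x) / complex_of_real ((1 / f (X x))\<^sup>2)) =
      l * complex_of_real (sqrt mu * sqrt (eps x) * (f (X x))\<^sup>2) * A l x"
    by (simp add: scaleR_conv_of_real power_divide)
  moreover have "sqrt mu * sqrt (eps x) * (f (X x))\<^sup>2 = c0 * mu * eps x"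
    unfolding f_X_sq using eps_pos[of x] mu_pos by (simp add: algebra_simps)
  ultimately show ?thesis by (simp add: o_def)
qed

text \<open>
  For initial amplitudes \<open>\<alpha>, \<beta>\<close> the coefficients are \<open>p, q = (\<alpha> \<plusminus> i c(0) \<mu> \<beta>) / 2\<close>.
\<close>

definition mode_E :: "real \<Rightarrow> complex \<Rightarrow> complex \<Rightarrow> real \<Rightarrow> real \<Rightarrow> complex" where
  "mode_E \<kappa> p q x t = exp (\<i> * complex_of_real (\<kappa> * t)) *
     (p * A (\<i> * complex_of_real \<kappa>) x + q * A (- \<i> * complex_of_real \<kappa>) x)"

definition mode_H :: "real \<Rightarrow> complex \<Rightarrow> complex \<Rightarrow> real \<Rightarrow> real \<Rightarrow> complex" where
  "mode_H \<kappa> p q x t = exp (\<i> * complex_of_real (\<kappa> * t)) *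
     (- \<i> / complex_of_real (c0 * mu) *
       (p * B (\<i> * complex_of_real \<kappa>) x + (- q) * B (- \<i> * complex_of_real \<kappa>) x))"

text \<open>Separation of variables: the time derivative multiplies by \<open>i \<kappa>\<close>,
  and the derivatives of \<open>A\<close> and \<open>B\<close> supply the rest. The minus sign
  before \<open>q\<close> in \<open>mode_H\<close> reflects the opposite spectral parameter of the
  second wave.\<close>

lemma maxwell_solution_mode: "maxwell_solution eps mu (mode_E \<kappa> p q) (mode_H \<kappa> p q)"
proof -
  let ?l = "\<i> * complex_of_real \<kappa>" and ?l' = "- \<i> * complex_of_real \<kappa>"
  let ?e = "\<lambda>t. exp (\<i> * complex_of_real (\<kappa> * t))"
  let ?h = "- \<i> / complex_of_real (c0 * mu)"
  define Ex where "Ex x t = ?e t * (p * (?l / complex_of_real c0 * B ?l x) + q * (?l' / complex_of_real c0 * B ?l' x))" for x t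
  define Hx where "Hx x t = ?e t * (?h * (p * (?l * complex_of_real (c0 * mu * eps x) * A ?l x) +
      (- q) * (?l' * complex_of_real (c0 * mu * eps x) * A ?l' x)))" for x t
  have e_deriv: "(?e has_vector_derivative ?l * ?e t) (at t)" for t
  proof -
    have "((\<lambda>z. exp (\<i> * (complex_of_real \<kappa> * z))) has_field_derivative ?l * ?e t) (at (complex_of_real t))"
      by (auto intro!: derivative_eq_intros)
    from has_vector_derivative_real_field[OF this] show ?thesis by simp
  qed
  have cA: "continuous_on UNIV (A l)" for l
    by (intro continuous_at_imp_continuous_on ballI) (rule has_vector_derivative_continuous[OF A_deriv])
  have cB: "continuous_on UNIV (B l)" for l
    by (intro continuous_at_imp_continuous_on ballI) (rule has_vector_derivative_continuous[OF B_deriv])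
  have cA': "continuous_on UNIV (\<lambda>p::real \<times> real. A l (fst p))" for l
    by (rule continuous_on_compose2[OF cA continuous_on_fst]) (auto intro: continuous_on_id)
  have cB': "continuous_on UNIV (\<lambda>p::real \<times> real. B l (fst p))" for l
    by (rule continuous_on_compose2[OF cB continuous_on_fst]) (auto intro: continuous_on_id)
  have ceps: "continuous_on UNIV (\<lambda>p::real \<times> real. eps (fst p))"
    by (rule continuous_on_compose2[OF eps_cont continuous_on_fst]) (auto intro: continuous_on_id)
  have nz: "complex_of_real c0 \<noteq> 0" "complex_of_real mu \<noteq> 0" using c_pos[of 0] mu_pos by auto
  show ?thesis
    unfolding maxwell_solution_def
  proof (rule exI[of _ Ex], rule exI[of _ "\<lambda>x t. ?l * mode_E \<kappa> p q x t"], rule exI[of _ Hx],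
      rule exI[of _ "\<lambda>x t. ?l * mode_H \<kappa> p q x t"], intro conjI allI)
    fix x t
    show "((\<lambda>y. mode_E \<kappa> p q y t) has_vector_derivative Ex x t) (at x)"
      unfolding mode_E_def Ex_def by (intro has_vector_derivative_add has_vector_derivative_mult_right A_deriv)
    show "((\<lambda>y. mode_H \<kappa> p q y t) has_vector_derivative Hx x t) (at x)"
      unfolding mode_H_def Hx_def by (intro has_vector_derivative_add has_vector_derivative_mult_right B_deriv)
    show "(mode_E \<kappa> p q x has_vector_derivative ?l * mode_E \<kappa> p q x t) (at t)"
      unfolding mode_E_def[abs_def] mult.assoc[symmetric, of ?l] by (intro has_vector_derivative_mult_left e_deriv)
    show "(mode_H \<kappa> p q x has_vector_derivative ?l * mode_H \<kappa> p q x t) (at t)"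
      unfolding mode_H_def[abs_def] mult.assoc[symmetric, of ?l] by (intro has_vector_derivative_mult_left e_deriv)
    show "complex_of_real (eps x) * (?l * mode_E \<kappa> p q x t) = \<i> * Hx x t"
      unfolding mode_E_def Hx_def using nz by (simp add: field_simps)
    show "\<i> * Ex x t = - complex_of_real mu * (?l * mode_H \<kappa> p q x t)"
      unfolding mode_H_def Ex_def using nz by (simp add: field_simps)
  next
    show "continuous_on UNIV (\<lambda>p. Ex (fst p) (snd p))"
      unfolding Ex_def by (intro continuous_intros cB') (use nz in auto)
    show "continuous_on UNIV (\<lambda>z. ?l * mode_E \<kappa> p q (fst z) (snd z))"
      unfolding mode_E_def by (intro continuous_intros cA')
    show "continuous_on UNIV (\<lambda>p. Hx (fst p) (snd p))"
      unfolding Hx_def by (intro continuous_intros cA' ceps) (use nz in auto)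
    show "continuous_on UNIV (\<lambda>z. ?l * mode_H \<kappa> p q (fst z) (snd z))"
      unfolding mode_H_def by (intro continuous_intros cB') (use nz in auto)
  qed
qed

section \<open>Normalisation and the Bessel form of the modes\<close>

text \<open>Combines the prefactor of the electric field with the constant in \<open>cplus\<close>
  and \<open>cminus\<close>; the result undoes the factor \<open>f\<close> in front of the spectral
  series.\<close>

lemma scale_E: "sqrt (c0 * eps 0) / sqrt (cc eps mu x * eps x) = 1 / f (X x)"
proof -
  have "sqrt (c0 * eps 0) / sqrt (cc eps mu x * eps x) = sqrt ((c0 * eps 0) / (cc eps mu x * eps x))"
    by (simp add: real_sqrt_divide)
  also have "(c0 * eps 0) / (cc eps mu x * eps x) = (1 / f (X x))\<^sup>2"
    using eps_pos[of 0] eps_pos[of x] mu_pos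
    by (simp add: power_divide f_X_sq) (simp add: cc_def real_sqrt_mult field_simps)
  also have "sqrt \<dots> = 1 / f (X x)" using f_X_pos[of x] by simp
  finally show ?thesis .
qed

lemma scale_H: "sqrt (c0 * eps 0) / sqrt (cc eps mu x * mu) = f (X x) / (c0 * mu)"
proof -
  have "sqrt (c0 * eps 0) / sqrt (cc eps mu x * mu) = sqrt ((c0 * eps 0) / (cc eps mu x * mu))"
    by (simp add: real_sqrt_divide)
  also have "(c0 * eps 0) / (cc eps mu x * mu) = (f (X x) / (c0 * mu))\<^sup>2"
    using eps_pos[of 0] eps_pos[of x] mu_pos
    by (simp add: power_divide f_X_sq) (simp add: cc_def real_sqrt_mult field_simps power2_eq_square)
  also have "sqrt \<dots> = f (X x) / (c0 * mu)" using f_X_pos[of x] c_pos[of 0] mu_pos by simp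
  finally show ?thesis .
qed

text \<open>Because \<open>c0 * sqrt (eps 0 * mu) = 1\<close>, the constants are a common real
  factor times twice the mode coefficients \<open>p\<close> and \<open>q\<close>.\<close>

lemma cplus_eq: "cplus eps mu a b = complex_of_real (sqrt (c0 * eps 0)) * (a + \<i> * complex_of_real (c0 * mu) * b)"
  and cminus_eq: "cminus eps mu a b = complex_of_real (sqrt (c0 * eps 0)) * (a - \<i> * complex_of_real (c0 * mu) * b)"
proof -
  have "sqrt (eps 0) * (c0 * mu) = sqrt mu"
    using eps_pos[of 0] mu_pos by (simp add: cc_def real_sqrt_mult real_div_sqrt)
  then have "complex_of_real (sqrt mu) = complex_of_real (sqrt (eps 0)) * complex_of_real (c0 * mu)"
    by (metis of_real_mult)
  then show "cplus eps mu a b = complex_of_real (sqrt (c0 * eps 0)) * (a + \<i> * complex_of_real (c0 * mu) * b)"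
    "cminus eps mu a b = complex_of_real (sqrt (c0 * eps 0)) * (a - \<i> * complex_of_real (c0 * mu) * b)"
    unfolding cplus_def cminus_def by (simp_all add: real_sqrt_mult algebra_simps)
qed

lemma mode_E_at_0: "mode_E \<kappa> p q 0 t = (p + q) * exp (\<i> * complex_of_real (\<kappa> * t))"
  by (simp add: mode_E_def spps_at_0)

lemma mode_H_at_0: "mode_H \<kappa> p q 0 t = - \<i> / complex_of_real (c0 * mu) * (p - q) * exp (\<i> * complex_of_real (\<kappa> * t))"
  by (simp add: mode_H_def spps_at_0)

lemma an_series:
  assumes "x \<noteq> 0"
  shows "(\<lambda>n. complex_of_real (an f n (X x)) * exp (complex_of_real (real n * pi / 2) * \<i>) * complex_of_real (sph_bessel n (\<kappa> * X x)))
     sums ((complex_of_real (f (X x)) * A (\<i> * complex_of_real \<kappa>) x - exp (\<i> * complex_of_real (\<kappa> * X x))) / 2)"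
    and "(\<lambda>n. (-1) ^ n * complex_of_real (an f n (X x)) * exp (complex_of_real (real n * pi / 2) * \<i>) * complex_of_real (sph_bessel n (\<kappa> * X x)))
     sums ((complex_of_real (f (X x)) * A (- \<i> * complex_of_real \<kappa>) x - exp (- \<i> * complex_of_real (\<kappa> * X x))) / 2)"
  by (rule an_bessel_sums[OF weight_f rangeI X_ne_0[OF assms]]
      an_bessel_alternating_sums[OF weight_f rangeI X_ne_0[OF assms]])+

lemma bn_series:
  assumes "x \<noteq> 0"
  shows "(\<lambda>n. complex_of_real (bn f n (X x)) * exp (complex_of_real (real n * pi / 2) * \<i>) * complex_of_real (sph_bessel n (\<kappa> * X x)))
     sums ((complex_of_real (1 / f (X x)) * B (\<i> * complex_of_real \<kappa>) x - exp (\<i> * complex_of_real (\<kappa> * X x))) / 2)"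
    and "(\<lambda>n. (-1) ^ n * complex_of_real (bn f n (X x)) * exp (complex_of_real (real n * pi / 2) * \<i>) * complex_of_real (sph_bessel n (\<kappa> * X x)))
     sums ((complex_of_real (1 / f (X x)) * B (- \<i> * complex_of_real \<kappa>) x - exp (- \<i> * complex_of_real (\<kappa> * X x))) / 2)"
  unfolding bn_eq_an_inverse
  by (rule an_bessel_sums[OF weight_inverse[OF weight_f] rangeI X_ne_0[OF assms]]
      an_bessel_alternating_sums[OF weight_inverse[OF weight_f] rangeI X_ne_0[OF assms]])+

text \<open>The explicit half exponentials cancel those contained in the sums of the Bessel series,
  leaving half of \<open>f * A\<close> for each wave.\<close>

lemma mode_E_bessel:
  assumes "x \<noteq> 0"
  shows "mode_E \<kappa> ((a + \<i> * complex_of_real (c0 * mu) * b) / 2) ((a - \<i> * complex_of_real (c0 * mu) * b) / 2) x t =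
    complex_of_real (1 / sqrt (cc eps mu x * eps x)) * (exp (\<i> * complex_of_real (\<kappa> * t)) *
      (cplus eps mu a b / 2 * exp (\<i> * complex_of_real (\<kappa> * X x))
       + cminus eps mu a b / 2 * exp (- \<i> * complex_of_real (\<kappa> * X x))
       + cplus eps mu a b * (\<Sum>n. complex_of_real (an f n (X x)) * exp (complex_of_real (real n * pi / 2) * \<i>)
            * complex_of_real (sph_bessel n (\<kappa> * X x)))
       + cminus eps mu a b * (\<Sum>n. (-1) ^ n * complex_of_real (an f n (X x)) * exp (complex_of_real (real n * pi / 2) * \<i>)
            * complex_of_real (sph_bessel n (\<kappa> * X x)))))"
proof -
  define u v where "u = a + \<i> * complex_of_real (c0 * mu) * b" and "v = a - \<i> * complex_of_real (c0 * mu) * b"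
  define G where "G = complex_of_real (f (X x))"
  define W R where "W = complex_of_real (1 / sqrt (cc eps mu x * eps x))" and "R = complex_of_real (sqrt (c0 * eps 0))"
  have "W * R = complex_of_real (1 / f (X x))"
    unfolding W_def R_def scale_E[of x, symmetric] of_real_mult[symmetric] by simp
  then have WR: "W * (R * (G * z)) = z" for z
    using f_X_pos[of x] by (simp add: G_def mult.assoc[symmetric])
  define A1 A2 e where "A1 = A (\<i> * complex_of_real \<kappa>) x" and "A2 = A (- \<i> * complex_of_real \<kappa>) x"
    and "e = exp (\<i> * complex_of_real (\<kappa> * t))"
  have "e * (u / 2 * A1 + v / 2 * A2) = W * (R * (G * (e * (u / 2 * A1 + v / 2 * A2))))"
    by (rule WR[symmetric])
  \<comment> \<open>\<open>z1\<close> and \<open>z2\<close> are arbitrary: the plane waves drop out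
    whatever their values, and are filled in by unification at the end.\<close>
  also have "\<dots> = W * (e * (R * u / 2 * z1 + R * v / 2 * z2 + R * u * ((G * A1 - z1) / 2) + R * v * ((G * A2 - z2) / 2)))" for z1 z2
    by (simp add: field_simps)
  finally show ?thesis
    unfolding an_series[OF assms, THEN sums_unique, symmetric] cplus_eq cminus_eq mode_E_def
      u_def[symmetric] v_def[symmetric] W_def[symmetric] R_def[symmetric] G_def[symmetric]
      A1_def[symmetric] A2_def[symmetric] e_def[symmetric] .
qed

lemma mode_H_bessel:
  assumes "x \<noteq> 0"
  shows "mode_H \<kappa> ((a + \<i> * complex_of_real (c0 * mu) * b) / 2) ((a - \<i> * complex_of_real (c0 * mu) * b) / 2) x t =
    - \<i> * complex_of_real (1 / sqrt (cc eps mu x * mu)) * (exp (\<i> * complex_of_real (\<kappa> * t)) *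
      (cplus eps mu a b / 2 * exp (\<i> * complex_of_real (\<kappa> * X x))
       - cminus eps mu a b / 2 * exp (- \<i> * complex_of_real (\<kappa> * X x))
       + cplus eps mu a b * (\<Sum>n. complex_of_real (bn f n (X x)) * exp (complex_of_real (real n * pi / 2) * \<i>)
            * complex_of_real (sph_bessel n (\<kappa> * X x)))
       - cminus eps mu a b * (\<Sum>n. (-1) ^ n * complex_of_real (bn f n (X x)) * exp (complex_of_real (real n * pi / 2) * \<i>)
            * complex_of_real (sph_bessel n (\<kappa> * X x)))))"
proof -
  define K where "K = complex_of_real (c0 * mu)"
  define u v where "u = a + \<i> * K * b" and "v = a - \<i> * K * b"
  define G where "G = complex_of_real (1 / f (X x))"
  define W R where "W = complex_of_real (1 / sqrt (cc eps mu x * mu))" and "R = complex_of_real (sqrt (c0 * eps 0))"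
  have "W * R = complex_of_real (f (X x) / (c0 * mu))"
    unfolding W_def R_def scale_H[of x, symmetric] of_real_mult[symmetric] by simp
  \<comment> \<open>For the magnetic field the weight is \<open>1 / f\<close>, so the
    \<open>f\<close> of the combined prefactor cancels and \<open>1 / K\<close> remains, which is
    the constant in \<open>mode_H\<close>.\<close>
  then have WR: "W * (R * (G * z)) = z / K" for z
    using f_X_pos[of x] by (simp add: G_def K_def mult.assoc[symmetric])
  define B1 B2 e where "B1 = B (\<i> * complex_of_real \<kappa>) x" and "B2 = B (- \<i> * complex_of_real \<kappa>) x"
    and "e = exp (\<i> * complex_of_real (\<kappa> * t))"
  have "e * (- \<i> / K * (u / 2 * B1 + - (v / 2) * B2)) = - \<i> * (W * (R * (G * (e * (u / 2 * B1 - v / 2 * B2)))))"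
    unfolding WR by simp
  also have "\<dots> = - \<i> * W * (e * (R * u / 2 * z1 - R * v / 2 * z2 + R * u * ((G * B1 - z1) / 2) - R * v * ((G * B2 - z2) / 2)))" for z1 z2
    by (simp add: field_simps)
  finally show ?thesis
    unfolding bn_series[OF assms, THEN sums_unique, symmetric] cplus_eq cminus_eq mode_H_def
      K_def[symmetric] u_def[symmetric] v_def[symmetric] W_def[symmetric] R_def[symmetric] G_def[symmetric]
      B1_def[symmetric] B2_def[symmetric] e_def[symmetric] .
qed

end

section \<open>Superposition of the modes and comparison with an arbitrary solution\<close>

theorem theorem2:
  fixes eps :: "real \<Rightarrow> real" and mu \<omega>0 \<omega> :: real and M :: nat
    and \<alpha> \<beta> :: "int \<Rightarrow> complex"
  assumes eps_pos: "\<forall>x. eps x > 0"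
    and eps_cont: "continuous_on UNIV eps"
    and mu_pos: "mu > 0"
    and f_C1: "fT eps mu C1_differentiable_on range (xi eps mu)"
  defines "k \<equiv> (\<lambda>m::int. \<omega>0 + real_of_int m * \<omega>)"
    and "f \<equiv> fT eps mu"
  shows "(\<exists>E H. maxwell_solution eps mu E H
            \<and> (\<forall>t. E 0 t = (\<Sum>m=-int M..int M. \<alpha> m * exp (\<i> * complex_of_real (k m * t))))
            \<and> (\<forall>t. H 0 t = (\<Sum>m=-int M..int M. \<beta> m * exp (\<i> * complex_of_real (k m * t)))))
    \<and> (\<forall>x m. x \<noteq> 0 \<longrightarrow>
            summable (\<lambda>n. complex_of_real (an f n (xi eps mu x)) * exp (complex_of_real (real n * pi / 2) * \<i>)
                          * complex_of_real (sph_bessel n (k m * xi eps mu x)))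
          \<and> summable (\<lambda>n. (-1) ^ n * complex_of_real (an f n (xi eps mu x)) * exp (complex_of_real (real n * pi / 2) * \<i>)
                          * complex_of_real (sph_bessel n (k m * xi eps mu x)))
          \<and> summable (\<lambda>n. complex_of_real (bn f n (xi eps mu x)) * exp (complex_of_real (real n * pi / 2) * \<i>)
                          * complex_of_real (sph_bessel n (k m * xi eps mu x)))
          \<and> summable (\<lambda>n. (-1) ^ n * complex_of_real (bn f n (xi eps mu x)) * exp (complex_of_real (real n * pi / 2) * \<i>)
                          * complex_of_real (sph_bessel n (k m * xi eps mu x))))
    \<and> (\<forall>E H. maxwell_solution eps mu E H
            \<and> (\<forall>t. E 0 t = (\<Sum>m=-int M..int M. \<alpha> m * exp (\<i> * complex_of_real (k m * t))))
            \<and> (\<forall>t. H 0 t = (\<Sum>m=-int M..int M. \<beta> m * exp (\<i> * complex_of_real (k m * t))))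
          \<longrightarrow> (\<forall>x t. x \<noteq> 0 \<longrightarrow>
            E x t = complex_of_real (1 / sqrt (cc eps mu x * eps x)) *
              (\<Sum>m=-int M..int M. exp (\<i> * complex_of_real (k m * t)) *
                 (cplus eps mu (\<alpha> m) (\<beta> m) / 2 * exp (\<i> * complex_of_real (k m * xi eps mu x))
                + cminus eps mu (\<alpha> m) (\<beta> m) / 2 * exp (- \<i> * complex_of_real (k m * xi eps mu x))
                + cplus eps mu (\<alpha> m) (\<beta> m) *
                    (\<Sum>n. complex_of_real (an f n (xi eps mu x)) * exp (complex_of_real (real n * pi / 2) * \<i>)
                          * complex_of_real (sph_bessel n (k m * xi eps mu x)))
                + cminus eps mu (\<alpha> m) (\<beta> m) *
                    (\<Sum>n. (-1) ^ n * complex_of_real (an f n (xi eps mu x)) * exp (complex_of_real (real n * pi / 2) * \<i>)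
                          * complex_of_real (sph_bessel n (k m * xi eps mu x)))))
          \<and> H x t = - \<i> * complex_of_real (1 / sqrt (cc eps mu x * mu)) *
              (\<Sum>m=-int M..int M. exp (\<i> * complex_of_real (k m * t)) *
                 (cplus eps mu (\<alpha> m) (\<beta> m) / 2 * exp (\<i> * complex_of_real (k m * xi eps mu x))
                - cminus eps mu (\<alpha> m) (\<beta> m) / 2 * exp (- \<i> * complex_of_real (k m * xi eps mu x))
                + cplus eps mu (\<alpha> m) (\<beta> m) *
                    (\<Sum>n. complex_of_real (bn f n (xi eps mu x)) * exp (complex_of_real (real n * pi / 2) * \<i>)
                          * complex_of_real (sph_bessel n (k m * xi eps mu x)))
                - cminus eps mu (\<alpha> m) (\<beta> m) *
                    (\<Sum>n. (-1) ^ n * complex_of_real (bn f n (xi eps mu x)) * exp (complex_of_real (real n * pi / 2) * \<i>)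
                          * complex_of_real (sph_bessel n (k m * xi eps mu x)))))))"
proof -
  interpret medium eps mu
    using eps_pos eps_cont mu_pos f_C1 by unfold_locales auto
  define p q where "p m = (\<alpha> m + \<i> * complex_of_real (cc eps mu 0 * mu) * \<beta> m) / 2"
    and "q m = (\<alpha> m - \<i> * complex_of_real (cc eps mu 0 * mu) * \<beta> m) / 2" for m
  define E0 where "E0 x t = (\<Sum>m=-int M..int M. mode_E (k m) (p m) (q m) x t)" for x t
  define H0 where "H0 x t = (\<Sum>m=-int M..int M. mode_H (k m) (p m) (q m) x t)" for x t
  have sol: "maxwell_solution eps mu E0 H0"
    unfolding E0_def[abs_def] H0_def[abs_def] by (intro maxwell_solution_sum maxwell_solution_mode)
  \<comment> \<open>The spectral series equal 1 at \<open>x = 0\<close>, so these two equations are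
    exactly the matching of the initial data, mode by mode.\<close>
  have pq: "p m + q m = \<alpha> m" "- \<i> / complex_of_real (cc eps mu 0 * mu) * (p m - q m) = \<beta> m" for m
    using c_pos[of 0] mu_pos unfolding p_def q_def by (simp_all add: field_simps)
  have E0_init: "E0 0 t = (\<Sum>m=-int M..int M. \<alpha> m * exp (\<i> * complex_of_real (k m * t)))" for t
    unfolding E0_def mode_E_at_0 pq ..
  have H0_init: "H0 0 t = (\<Sum>m=-int M..int M. \<beta> m * exp (\<i> * complex_of_real (k m * t)))" for t
    unfolding H0_def mode_H_at_0 pq ..
  show ?thesis
    unfolding f_def
  proof (intro conjI allI impI)
    show "\<exists>E H. maxwell_solution eps mu E H
            \<and> (\<forall>t. E 0 t = (\<Sum>m=-int M..int M. \<alpha> m * exp (\<i> * complex_of_real (k m * t))))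
            \<and> (\<forall>t. H 0 t = (\<Sum>m=-int M..int M. \<beta> m * exp (\<i> * complex_of_real (k m * t))))"
      using sol E0_init H0_init by blast
  next
    fix E H x t
    assume EH: "maxwell_solution eps mu E H
            \<and> (\<forall>t. E 0 t = (\<Sum>m=-int M..int M. \<alpha> m * exp (\<i> * complex_of_real (k m * t))))
            \<and> (\<forall>t. H 0 t = (\<Sum>m=-int M..int M. \<beta> m * exp (\<i> * complex_of_real (k m * t))))"
      and x: "x \<noteq> (0::real)"
    \<comment> \<open>By uniqueness any solution with these data is the superposition
      \<open>E0\<close>, \<open>H0\<close>, so the formulas need checking for single modes
      only.\<close>
    have eq: "E x t = E0 x t \<and> H x t = H0 x t"
      by (rule maxwell_solution_unique) (use EH sol E0_init H0_init in auto)
    show "E x t = complex_of_real (1 / sqrt (cc eps mu x * eps x)) *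
              (\<Sum>m=-int M..int M. exp (\<i> * complex_of_real (k m * t)) *
                 (cplus eps mu (\<alpha> m) (\<beta> m) / 2 * exp (\<i> * complex_of_real (k m * xi eps mu x))
                + cminus eps mu (\<alpha> m) (\<beta> m) / 2 * exp (- \<i> * complex_of_real (k m * xi eps mu x))
                + cplus eps mu (\<alpha> m) (\<beta> m) *
                    (\<Sum>n. complex_of_real (an (fT eps mu) n (xi eps mu x)) * exp (complex_of_real (real n * pi / 2) * \<i>)
                          * complex_of_real (sph_bessel n (k m * xi eps mu x)))
                + cminus eps mu (\<alpha> m) (\<beta> m) *
                    (\<Sum>n. (-1) ^ n * complex_of_real (an (fT eps mu) n (xi eps mu x)) * exp (complex_of_real (real n * pi / 2) * \<i>)
                          * complex_of_real (sph_bessel n (k m * xi eps mu x)))))"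
      unfolding eq[THEN conjunct1] E0_def p_def q_def mode_E_bessel[OF x] sum_distrib_left ..
    show "H x t = - \<i> * complex_of_real (1 / sqrt (cc eps mu x * mu)) *
              (\<Sum>m=-int M..int M. exp (\<i> * complex_of_real (k m * t)) *
                 (cplus eps mu (\<alpha> m) (\<beta> m) / 2 * exp (\<i> * complex_of_real (k m * xi eps mu x))
                - cminus eps mu (\<alpha> m) (\<beta> m) / 2 * exp (- \<i> * complex_of_real (k m * xi eps mu x))
                + cplus eps mu (\<alpha> m) (\<beta> m) *
                    (\<Sum>n. complex_of_real (bn (fT eps mu) n (xi eps mu x)) * exp (complex_of_real (real n * pi / 2) * \<i>)
                          * complex_of_real (sph_bessel n (k m * xi eps mu x)))
                - cminus eps mu (\<alpha> m) (\<beta> m) *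
                    (\<Sum>n. (-1) ^ n * complex_of_real (bn (fT eps mu) n (xi eps mu x)) * exp (complex_of_real (real n * pi / 2) * \<i>)
                          * complex_of_real (sph_bessel n (k m * xi eps mu x)))))"
      unfolding eq[THEN conjunct2] H0_def p_def q_def mode_H_bessel[OF x] sum_distrib_left ..
  qed (use an_series bn_series in \<open>blast intro: sums_summable\<close>)+
qed

end
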